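(* For each $N$, let $p_{j,N}$, $j=1,\dots,N$, be the poles of the degree-$N$ best (minimax) rational approximant to $\sqrt{x}$ on $[0,1]$, ordered by increasing absolute value. For each fixed integer $k\ge 0$, $$p_{N-k,N} \sim -\frac{8N}{(2k+1)^2\pi^2}, \qquad N\to\infty.$$ In particular, the largest pole satisfies $p_{N,N}\sim -\frac{8N}{\pi^2}$.
   Context: The degree-$N$ best rational approximant is the rational function $p/q$ with $p,q$ polynomials of degree at most $N$ minimizing $\max_{x\in[0,1]}|\sqrt{x}-p(x)/q(x)|$; its poles lie on the negative real axis. *)

theory Defs
  imports "HOL-Analysis.Analysis" "HOL-Computational_Algebra.Computational_Algebra"
    "HOL-Library.Landau_Symbols"
begin

definition sqrt_err :: "real poly \<Rightarrow> real poly \<Rightarrow> real" where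
  "sqrt_err p q = (SUP x\<in>{0..1}. \<bar>sqrt x - poly p x / poly q x\<bar>)"

definition rat_cand :: "nat \<Rightarrow> real poly \<Rightarrow> real poly \<Rightarrow> bool" where
  "rat_cand N p q \<longleftrightarrow> degree p \<le> N \<and> degree q \<le> N \<and> (\<forall>x\<in>{0..1}. poly q x \<noteq> 0)"

definition best_sqrt_approx :: "nat \<Rightarrow> real poly \<Rightarrow> real poly \<Rightarrow> bool" where
  "best_sqrt_approx N p q \<longleftrightarrow> rat_cand N p q \<and> coprime p q \<and>
     (\<forall>p' q'. rat_cand N p' q' \<longrightarrow> sqrt_err p q \<le> sqrt_err p' q')"

definition poles :: "real poly \<Rightarrow> complex multiset" where
  "poles q = proots (map_poly complex_of_real q)"

end

theory Submission
  imports Defs "HOL-Real_Asymp.Real_Asymp" "HOL-Computational_Algebra.Field_as_Ring"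
begin

text \<open>
  Put \<open>x = t\<^sup>2\<close>. By equioscillation \<open>h(t) = t q(t\<^sup>2) - p(t\<^sup>2)\<close> has exactly \<open>n = 2N + 1\<close> zeros
  \<open>\<tau>\<^sub>i \<in> (0, 1)\<close>, interlacing the extremal points. Since \<open>2 t q(t\<^sup>2) = h(t) - h(-t)\<close>, the poles are the numbers
  \<open>-1/s\<^sup>2\<close> where \<open>\<Sum> arctan (\<tau>\<^sub>i s)\<close> is an odd multiple of \<open>\<pi>/2\<close>; for the large poles \<open>s\<close> is small and
  the sum is close to \<open>s \<Sum> \<tau>\<^sub>i\<close>. Everything therefore reduces to \<open>\<Sum> \<tau>\<^sub>i \<sim> \<surd>(2N)\<close>.

  With error \<open>e\<close>, minimax error \<open>E\<close> and \<open>L = -ln E\<close>, the potential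
  \<open>f = \<Sum> ln \<bar>(t + \<tau>\<^sub>i)/(t - \<tau>\<^sub>i)\<bar> = ln \<bar>(2t - e)/e\<bar>\<close> is at least \<open>ln (t/E)\<close> on \<open>[E, 1]\<close> and at most
  \<open>ln (3t/E)\<close> at the extremal points; convexity in \<open>u = ln t\<close> extends the upper bound to all of \<open>[E, 1]\<close>, up to
  logarithmic spikes at the zeros whose total mass is \<open>O(L)\<close>. Integrating \<open>f\<close> against \<open>du\<close>, under which every
  summand has mass \<open>\<pi>\<^sup>2/2\<close>, gives \<open>n \<pi>\<^sup>2 = L\<^sup>2 + O(L)\<close>. Integrating it against
  \<open>t dt / \<surd>(R\<^sup>2 - t\<^sup>2)\<close> on \<open>[0, R]\<close>, under which the \<open>i\<close>-th summand has mass \<open>\<pi> \<tau>\<^sub>i\<close>, and letting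
  \<open>R\<close> tend to 1 gives \<open>\<pi> \<Sum> \<tau>\<^sub>i \<sim> L\<close>.
\<close>

section \<open>Integrals of the logarithmic kernel\<close>

lemma has_integral_substitution_nonneg:
  fixes f g g' :: "real \<Rightarrow> real"
  assumes "(f has_integral b) (g ` S)"
    and "\<And>x. x \<in> S \<Longrightarrow> 0 \<le> f (g x)"
    and "S \<in> sets lebesgue" "inj_on g S"
    and "\<And>x. x \<in> S \<Longrightarrow> (g has_field_derivative g' x) (at x within S)"
  shows "((\<lambda>x. \<bar>g' x\<bar> * f (g x)) has_integral b) S"
proof -
  \<comment> \<open>For a nonnegative integrand, integrability is absolute integrability, which is
    what the change of variables theorem asks for.\<close>
  have "f absolutely_integrable_on (g ` S) \<and> integral (g ` S) f = b"
    using assms(1,2) nonnegative_absolutely_integrable_1[of f "g ` S"] by (auto simp: integral_unique)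
  then have "(\<lambda>x. \<bar>g' x\<bar> * f (g x)) absolutely_integrable_on S
      \<and> integral S (\<lambda>x. \<bar>g' x\<bar> * f (g x)) = b"
    using has_absolute_integral_change_of_variables_1'[OF assms(3,5,4)] by simp
  then show ?thesis
    using integrable_integral set_lebesgue_integral_eq_integral(1) by blast
qed

lemma has_integral_finite_diff:
  fixes f :: "real \<Rightarrow> real"
  assumes "(f has_integral y) S" "finite (S - T)" "finite (T - S)"
  shows "(f has_integral y) T"
proof (subst has_integral_spike_set_eq[of T S])
  show "negligible {x \<in> T - S. f x \<noteq> 0}" "negligible {x \<in> S - T. f x \<noteq> 0}"
    using assms(2,3) by (auto intro: negligible_subset[OF negligible_finite])
qed fact

text \<open>This is ln coth(|v|/2). For t = exp u and \<tau> = exp a,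
  \<open>log_coth (u - a)\<close> is ln |(t + \<tau>)/(t - \<tau>)|, so logarithmic coordinates turn
  the kernel into a translate of one function. At the singularity v = 0 the conventions for division
  and \<open>ln\<close> give the value 0 instead of infinity.\<close>

definition log_coth :: "real \<Rightarrow> real" where
  "log_coth v = ln \<bar>(exp v + 1) / (exp v - 1)\<bar>"

lemma log_coth_minus [simp]: "log_coth (- v) = log_coth v"
proof -
  have "(exp (-v) + 1) / (exp (-v) - 1) = - ((exp v + 1) / (exp v - 1))"
    by (cases "v = 0") (auto simp: exp_minus field_simps)
  then show ?thesis by (simp add: log_coth_def)
qed

lemma log_coth_0 [simp]: "log_coth 0 = 0"
  by (simp add: log_coth_def)

lemma log_coth_abs: "log_coth \<bar>v\<bar> = log_coth v"
  by (simp add: abs_if)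

lemma log_coth_pos_eq:
  assumes "0 < v"
  shows "log_coth v = ln (exp v + 1) - ln (exp v - 1)"
proof -
  have "0 < exp v + 1" "0 < exp v - 1"
    using assms exp_gt_zero[of v] by (linarith, simp del: exp_gt_zero)
  from ln_divide_pos[OF this] divide_pos_pos[OF this] show ?thesis
    by (simp only: log_coth_def abs_of_pos)
qed



lemma log_coth_pos:
  assumes "v \<noteq> 0"
  shows "0 < log_coth v"
proof -
  have "0 < log_coth \<bar>v\<bar>"
    using assms exp_gt_zero[of "\<bar>v\<bar>"]
    by (subst log_coth_pos_eq) (auto simp del: exp_gt_zero intro!: ln_less_cancel_iff[THEN iffD2])
  then show ?thesis by (simp add: log_coth_abs)
qed

lemma log_coth_nonneg: "0 \<le> log_coth v"
  by (cases "v = 0") (auto simp: log_coth_def dest: log_coth_pos)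

text \<open>The derivative is -1/sinh v; its monotonicity gives convexity, and comparing it with
  -1/v controls the singularity.\<close>

lemma log_coth_has_derivative:
  assumes "0 < v"
  shows "(log_coth has_real_derivative - (2 / (exp v - exp (- v)))) (at v)"
proof -
  have *: "((\<lambda>v. ln (exp v + 1) - ln (exp v - 1)) has_real_derivative
      - (2 / (exp v - exp (- v)))) (at v)"
  proof (rule DERIV_cong)
    have pos: "0 < exp v + 1" "0 < exp v - 1"
    using assms exp_gt_zero[of v] by (linarith, simp del: exp_gt_zero)
    show "((\<lambda>v. ln (exp v + 1) - ln (exp v - 1)) has_real_derivative
        exp v / (exp v + 1) - exp v / (exp v - 1)) (at v)"
      by (rule derivative_eq_intros refl pos | simp)+
    have "exp v - exp (- v) = (exp v + 1) * (exp v - 1) / exp v"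
      by (simp add: exp_minus field_simps)
    moreover have "y / (y + 1) - y / (y - 1) = - (2 / ((y + 1) * (y - 1) / y))" if "1 < y" for y :: real
    proof -
      have "y / (y + 1) - y / (y - 1) = (y * (y - 1) - y * (y + 1)) / ((y + 1) * (y - 1))"
        using that by (subst diff_frac_eq) (auto simp: algebra_simps)
      then show ?thesis by (simp add: algebra_simps)
    qed
    ultimately show "exp v / (exp v + 1) - exp v / (exp v - 1) = - (2 / (exp v - exp (- v)))"
      using assms by simp
  qed
  show ?thesis
    by (rule DERIV_cong_ev[THEN iffD1, OF refl _ refl *])
       (use assms eventually_nhds_in_open[of "{0<..}" v] in
         \<open>auto elim!: eventually_mono simp: log_coth_pos_eq\<close>)
qed

lemma log_coth_convex: "convex_on {0<..} log_coth"
proof (rule convex_on_realI)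
  show "- (2 / (exp x - exp (- x))) \<le> - (2 / (exp y - exp (- y)))"
    if "x \<in> {0<..}" "y \<in> {0<..}" "x \<le> y" for x y :: real
  proof -
    have "exp x - exp (-x) \<le> exp y - exp (-y)" "0 < exp x - exp (-x)"
      using that by (auto intro: diff_mono)
    then show ?thesis by (simp add: frac_le)
  qed
qed (auto intro: log_coth_has_derivative)

lemma log_coth_antimono:
  assumes "0 < v" "v \<le> w"
  shows "log_coth w \<le> log_coth v"
proof (rule DERIV_nonpos_imp_nonincreasing[OF assms(2)])
  fix x assume "v \<le> x" "x \<le> w"
  then show "\<exists>y. (log_coth has_real_derivative y) (at x) \<and> y \<le> 0"
    using assms by (intro exI[of _ "- (2 / (exp x - exp (- x)))"]) (auto intro: log_coth_has_derivative)
qed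

lemma two_sinh_ge:
  assumes "0 \<le> (v::real)"
  shows "2 * v \<le> exp v - exp (- v)"
proof -
  have "exp 0 - exp (- 0) - 2 * 0 \<le> exp v - exp (- v) - 2 * v"
  proof (rule DERIV_nonneg_imp_nondecreasing[OF assms])
    fix x :: real
    have "2 \<le> exp x + exp (- x)"
      using sum_power2_ge_zero[of "exp (x/2) - exp (-x/2)" 0]
      by (simp add: power2_eq_square algebra_simps flip: exp_add)
    then show "\<exists>y. ((\<lambda>x. exp x - exp (- x) - 2 * x) has_real_derivative y) (at x) \<and> 0 \<le> y"
      by (intro exI[of _ "exp x + exp (- x) - 2"]) (auto intro!: derivative_eq_intros)
  qed
  then show ?thesis by simp
qed

text \<open>Since sinh x >= x, the sum \<open>log_coth x + ln x\<close> is nondecreasing: near 0 the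
  kernel grows no faster than -ln v.\<close>

lemma log_coth_diff_le:
  assumes "0 < v" "v \<le> d"
  shows "log_coth v - log_coth d \<le> ln (d / v)"
proof -
  have "log_coth v + ln v \<le> log_coth d + ln d"
  proof (rule DERIV_nonneg_imp_nondecreasing[OF assms(2)])
    fix x assume x: "v \<le> x" "x \<le> d"
    have "0 < x" using x assms by linarith
    have "2 / (exp x - exp (-x)) \<le> 2 / (2 * x)"
      using two_sinh_ge[of x] \<open>0 < x\<close> by (intro divide_left_mono) auto
    then show "\<exists>y. ((\<lambda>x. log_coth x + ln x) has_real_derivative y) (at x) \<and> 0 \<le> y"
      using \<open>0 < x\<close>
      by (intro exI[of _ "- (2 / (exp x - exp (- x))) + 1 / x"])
         (auto intro!: derivative_eq_intros log_coth_has_derivative)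
  qed
  then show ?thesis using assms by (simp add: ln_div)
qed

text \<open>Expansion of ln((1 + w)/(1 - w)) = 2 (w + w^3/3 + ...) at w = exp(-v). Its positive
  terms give both the decay estimate and the integral below.\<close>

lemma log_coth_sums:
  assumes "0 < v"
  shows "(\<lambda>k. 2 * exp (- real (2 * k + 1) * v) / real (2 * k + 1)) sums log_coth v"
proof -
  define x where "x = (exp v + 1) / (exp v - 1)"
  have "0 < exp v - 1" using assms by simp
  then have x: "0 < x" "(x - 1) / (x + 1) = exp (- v)"
    by (auto simp: x_def field_simps exp_minus add_pos_pos)
  have "exp (- v) ^ (2 * k + 1) = exp (- real (2 * k + 1) * v)" for k
    by (subst exp_of_nat_mult[symmetric]) (simp add: algebra_simps)
  then have "(\<lambda>k. 2 * exp (- real (2 * k + 1) * v) / real (2 * k + 1)) sums ln x"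
    using ln_series_quadratic[OF x(1)] by (simp add: x(2) del: of_nat_Suc of_nat_add)
  then show ?thesis
    using x(1) by (simp only: log_coth_def x_def[symmetric] abs_of_pos)
qed

text \<open>Compared term by term: the exponent (2k + 1)(w - v) is at least w - v. This carries a
  bound on the potential at an outermost node further outwards.\<close>

lemma log_coth_exp_decay:
  assumes "0 < v" "v \<le> w"
  shows "log_coth w \<le> exp (v - w) * log_coth v"
proof (rule sums_le)
  show "(\<lambda>k. 2 * exp (- real (2 * k + 1) * w) / real (2 * k + 1)) sums log_coth w"
    using assms by (intro log_coth_sums) auto
  show "(\<lambda>k. exp (v - w) * (2 * exp (- real (2 * k + 1) * v) / real (2 * k + 1)))
      sums (exp (v - w) * log_coth v)"
    using assms by (intro sums_mult log_coth_sums)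
  fix k :: nat
  have "- real (2 * k + 1) * w \<le> (v - w) + - real (2 * k + 1) * v"
    using mult_left_mono[OF assms(2), of "2 * real k"] by (simp add: algebra_simps)
  then have "exp (- real (2 * k + 1) * w) \<le> exp (v - w) * exp (- real (2 * k + 1) * v)"
    by (simp flip: exp_add)
  then have "2 * exp (- real (2 * k + 1) * w) / real (2 * k + 1)
      \<le> 2 * (exp (v - w) * exp (- real (2 * k + 1) * v)) / real (2 * k + 1)"
    by (intro divide_right_mono mult_left_mono) auto
  then show "2 * exp (- real (2 * k + 1) * w) / real (2 * k + 1)
      \<le> exp (v - w) * (2 * exp (- real (2 * k + 1) * v) / real (2 * k + 1))"
    by (simp only: mult.left_commute times_divide_eq_right)
qed

lemma odd_inverse_squares_sums: "(\<lambda>k. 1 / real (2 * k + 1) ^ 2) sums (pi\<^sup>2 / 8)"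
proof -
  let ?f = "\<lambda>n. 1 / (real n + 1)\<^sup>2"
  have *: "?f sums (pi\<^sup>2 / 6)"
    using inverse_squares_sums by (simp add: add.commute)
  \<comment> \<open>Grouping in pairs separates the odd denominators from the even ones, which make
    up a quarter of the whole sum.\<close>
  have "(\<lambda>n. \<Sum>i\<in>{n * 2..<n * 2 + 2}. ?f i) sums (pi\<^sup>2 / 6)"
    by (rule sums_group[OF *]) simp
  moreover have "(\<Sum>i\<in>{n * 2..<n * 2 + 2}. ?f i) = 1 / real (2 * n + 1) ^ 2 + 1 / 4 * ?f n" for n
  proof -
    have "{n * 2..<n * 2 + 2} = {2 * n, 2 * n + 1}" by auto
    then show ?thesis by (simp add: field_simps power2_eq_square)
  qed
  ultimately have "(\<lambda>n. 1 / real (2 * n + 1) ^ 2 + 1 / 4 * ?f n) sums (pi\<^sup>2 / 6)"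
    by simp
  from sums_diff[OF this sums_mult[OF *, of "1/4"]] show ?thesis by simp
qed

lemma log_coth_has_integral: "(log_coth has_integral pi\<^sup>2 / 2) UNIV"
proof -
  \<comment> \<open>The partial sums integrate on the half line to 2 times the sums of 1/(2k + 1)^2.
    Monotone convergence gives pi^2/4 there, and evenness doubles it.\<close>
  define s where "s = (\<lambda>K v. \<Sum>k<K. 2 * exp (- real (2 * k + 1) * v) / real (2 * k + 1))"
  have s_int: "(s K has_integral (\<Sum>k<K. 2 * (1 / real (2 * k + 1) ^ 2))) {0<..}" for K
    unfolding s_def
  proof (rule has_integral_sum)
    fix k
    have "((\<lambda>v. exp (- real (2 * k + 1) * v)) has_integral
        exp (- real (2 * k + 1) * 0) / real (2 * k + 1)) {0..}"
      by (rule has_integral_exp_minus_to_infinity) simp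
    then have "((\<lambda>v. exp (- real (2 * k + 1) * v)) has_integral
        exp (- real (2 * k + 1) * 0) / real (2 * k + 1)) {0<..}"
      by (rule has_integral_finite_diff) (auto intro: finite_subset[of _ "{0}"])
    from has_integral_mult_right[OF this, of "2 / real (2 * k + 1)"]
    show "((\<lambda>v. 2 * exp (- real (2 * k + 1) * v) / real (2 * k + 1)) has_integral
        2 * (1 / real (2 * k + 1) ^ 2)) {0<..}"
      by (simp add: power2_eq_square)
  qed simp
  have half: "(log_coth has_integral 2 * (pi\<^sup>2 / 8)) {0<..}"
  proof (rule has_integral_monotone_convergence_increasing[OF s_int])
    show "(\<lambda>K. \<Sum>k<K. 2 * (1 / real (2 * k + 1) ^ 2)) \<longlonglongrightarrow> 2 * (pi\<^sup>2 / 8)"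
      using sums_mult[OF odd_inverse_squares_sums] unfolding sums_def .
    show "(\<lambda>k. s k x) \<longlonglongrightarrow> log_coth x" if "x \<in> {0<..}" for x
      using log_coth_sums[of x] that by (simp add: sums_def s_def)
  qed (simp add: s_def)
  have "((\<lambda>x. \<bar>-1\<bar> * log_coth (- x)) has_integral 2 * (pi\<^sup>2 / 8)) {..<0}"
  proof (rule has_integral_substitution_nonneg[where g = uminus])
    have "uminus ` {..<0::real} = {0<..}" by auto
    then show "(log_coth has_integral 2 * (pi\<^sup>2 / 8)) (uminus ` {..<0})"
      using half by simp
  qed (auto simp: log_coth_nonneg intro!: derivative_eq_intros)
  then have "(log_coth has_integral 2 * (pi\<^sup>2 / 8) + 2 * (pi\<^sup>2 / 8)) ({..<0} \<union> {0<..})"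
    using half by (intro has_integral_Un) (auto intro: negligible_subset[of "{}"])
  then have "(log_coth has_integral 2 * (pi\<^sup>2 / 8) + 2 * (pi\<^sup>2 / 8)) UNIV"
    by (rule has_integral_finite_diff) (auto intro: finite_subset[of _ "{0}"])
  then show ?thesis by simp
qed

lemma log_coth_shift_has_integral: "((\<lambda>u. log_coth (u - a)) has_integral pi\<^sup>2 / 2) UNIV"
proof -
  have "((\<lambda>u. \<bar>1\<bar> * log_coth (u - a)) has_integral pi\<^sup>2 / 2) UNIV"
  proof (rule has_integral_substitution_nonneg[where g = "\<lambda>u. u - a"])
    have "range (\<lambda>u. u - a) = UNIV"
      by (auto intro!: image_eqI[of _ _ "_ + a"])
    then show "(log_coth has_integral pi\<^sup>2 / 2) (range (\<lambda>u. u - a))"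
      using log_coth_has_integral by simp
  qed (auto simp: log_coth_nonneg inj_on_def intro!: derivative_eq_intros)
  then show ?thesis by simp
qed

section \<open>Integrals against the arcsine weight\<close>

lemma continuous_mult_ln_abs: "continuous_on UNIV (\<lambda>z::real. z * ln \<bar>z\<bar>)"
proof -
  have "isCont (\<lambda>z::real. z * ln \<bar>z\<bar>) x" for x
  proof (cases "x = 0")
    case True
    have "((\<lambda>z::real. z * ln \<bar>z\<bar>) \<longlongrightarrow> 0) (at_right 0)"
      "((\<lambda>z::real. z * ln \<bar>z\<bar>) \<longlongrightarrow> 0) (at_left 0)"
      by real_asymp+
    then have "((\<lambda>z::real. z * ln \<bar>z\<bar>) \<longlongrightarrow> 0) (at 0)"
      by (simp add: filterlim_split_at)
    then show ?thesis by (simp add: True isCont_def)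
  qed (auto intro!: continuous_intros)
  then show ?thesis by (simp add: continuous_on_eq_continuous_at)
qed

text \<open>Integration by parts with -sqrt(R^2 - s^2) as antiderivative of the weight leaves 2 t
  sqrt(R^2 - s^2)/(t^2 - s^2). Writing R^2 - s^2 = (t^2 - s^2) + c^2 splits this into the
  \<open>arcsin\<close> term and logarithms. The multiples of ln |t^2 - s^2| are collected with a
  factor that vanishes at s = t, which keeps the antiderivative continuous there.\<close>

lemma arcsine_log_antiderivative:
  fixes t s R :: real
  assumes "0 < t" "t < R" "0 < s" "s < R" "s \<noteq> t"
  defines "c \<equiv> sqrt (R\<^sup>2 - t\<^sup>2)"
  shows "((\<lambda>s. 2 * c * ln (t * sqrt (R\<^sup>2 - s\<^sup>2) + c * s) - 2 * sqrt (R\<^sup>2 - s\<^sup>2) * ln (t + s)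
      + 2 * t * arcsin (s / R) + (sqrt (R\<^sup>2 - s\<^sup>2) - c) * ln \<bar>t\<^sup>2 - s\<^sup>2\<bar>)
    has_real_derivative s / sqrt (R\<^sup>2 - s\<^sup>2) * ln \<bar>(s + t) / (s - t)\<bar>) (at s)"
proof -
  define q where "q = sqrt (R\<^sup>2 - s\<^sup>2)"
  have "t\<^sup>2 < R\<^sup>2" "s\<^sup>2 < R\<^sup>2" using assms by (auto intro: power_strict_mono)
  then have pos: "0 < c" "0 < q" and sq: "c\<^sup>2 = R\<^sup>2 - t\<^sup>2" "q\<^sup>2 = R\<^sup>2 - s\<^sup>2"
    by (auto simp: c_def q_def)
  have "0 < R" using assms by simp
  have "t\<^sup>2 \<noteq> s\<^sup>2" using assms power2_eq_iff_nonneg[of t s] by auto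
  then have nz: "t\<^sup>2 - s\<^sup>2 \<noteq> 0" "t + s \<noteq> 0" "t * q + c * s > 0"
    using assms pos by (auto intro: add_pos_pos)
  have dq: "((\<lambda>s. sqrt (R\<^sup>2 - s\<^sup>2)) has_real_derivative - s / q) (at s)"
    using pos \<open>s\<^sup>2 < R\<^sup>2\<close>
    by (auto intro!: derivative_eq_intros simp: q_def field_simps)
  have dl1: "((\<lambda>s. ln (t * sqrt (R\<^sup>2 - s\<^sup>2) + c * s)) has_real_derivative
      (t * (- s / q) + c) / (t * q + c * s)) (at s)"
  proof -
    have ln': "((\<lambda>s. ln (g s)) has_real_derivative D / g s) (at s)"
      if "(g has_real_derivative D) (at s)" "0 < g s" for g D
      using that by (auto intro!: derivative_eq_intros)
    have "((\<lambda>s. t * sqrt (R\<^sup>2 - s\<^sup>2) + c * s) has_real_derivative t * (- s / q) + c * 1) (at s)"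
      by (intro DERIV_add DERIV_cmult dq DERIV_ident)
    from ln'[OF this] show ?thesis using nz(3) by (simp add: q_def)
  qed
  have dl2: "((\<lambda>s. ln (t + s)) has_real_derivative 1 / (t + s)) (at s)"
    using assms by (auto intro!: derivative_eq_intros)
  have das: "((\<lambda>s. arcsin (s / R)) has_real_derivative 1 / q) (at s)"
  proof -
    have "sqrt (1 - (s / R)\<^sup>2) = q / R"
    proof -
      have "1 - (s / R)\<^sup>2 = (R\<^sup>2 - s\<^sup>2) / R\<^sup>2"
        using \<open>0 < R\<close> by (simp add: power_divide diff_divide_distrib)
      then show ?thesis using \<open>0 < R\<close> by (simp only: q_def real_sqrt_divide real_sqrt_abs abs_of_pos)
    qed
    moreover have "-1 < s / R" "s / R < 1" using assms by (auto simp: field_simps)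
    ultimately show ?thesis
      using \<open>0 < R\<close> pos by (auto intro!: derivative_eq_intros simp: field_simps)
  qed
  have dl3: "((\<lambda>s. ln \<bar>t\<^sup>2 - s\<^sup>2\<bar>) has_real_derivative - 2 * s / (t\<^sup>2 - s\<^sup>2)) (at s)"
  proof (cases "s < t")
    case True
    then have "0 < t\<^sup>2 - s\<^sup>2" using assms by (simp add: power_strict_mono)
    then have "((\<lambda>s. ln (t\<^sup>2 - s\<^sup>2)) has_real_derivative - 2 * s / (t\<^sup>2 - s\<^sup>2)) (at s)"
      by (auto intro!: derivative_eq_intros)
    then show ?thesis
      by (rule DERIV_cong_ev[THEN iffD1, OF refl _ refl, rotated])
         (use assms True eventually_nhds_in_open[of "{0<..<t}" s] in
           \<open>auto elim!: eventually_mono simp: power_mono\<close>)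
  next
    case False
    then have "0 < s\<^sup>2 - t\<^sup>2" using assms by (simp add: power_strict_mono)
    then have "((\<lambda>s. ln (s\<^sup>2 - t\<^sup>2)) has_real_derivative - 2 * s / (t\<^sup>2 - s\<^sup>2)) (at s)"
      by (auto intro!: derivative_eq_intros simp: field_simps)
    then show ?thesis
      by (rule DERIV_cong_ev[THEN iffD1, OF refl _ refl, rotated])
         (use assms False eventually_nhds_in_open[of "{t<..}" s] in
           \<open>auto elim!: eventually_mono simp: power_mono\<close>)
  qed
  show ?thesis
  proof (rule DERIV_cong)
    show "((\<lambda>s. 2 * c * ln (t * sqrt (R\<^sup>2 - s\<^sup>2) + c * s) - 2 * sqrt (R\<^sup>2 - s\<^sup>2) * ln (t + s)
      + 2 * t * arcsin (s / R) + (sqrt (R\<^sup>2 - s\<^sup>2) - c) * ln \<bar>t\<^sup>2 - s\<^sup>2\<bar>) has_real_derivative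
      (2 * c * ((t * (- s / q) + c) / (t * q + c * s))
      - (2 * (- s / q) * ln (t + s) + 2 * q * (1 / (t + s)))
      + 2 * t * (1 / q) + ((- s / q) * ln \<bar>t\<^sup>2 - s\<^sup>2\<bar> + (q - c) * (- 2 * s / (t\<^sup>2 - s\<^sup>2))))) (at s)"
    proof -
      have comb: "((\<lambda>s. 2 * c * A s - 2 * Q s * B s + 2 * t * C s + (Q s - c) * D s)
          has_real_derivative 2 * c * A' - (2 * Q' * B s + 2 * Q s * B') + 2 * t * C'
            + (Q' * D s + (Q s - c) * D')) (at s)"
        if "(A has_real_derivative A') (at s)" "(Q has_real_derivative Q') (at s)"
          "(B has_real_derivative B') (at s)" "(C has_real_derivative C') (at s)"
          "(D has_real_derivative D') (at s)" for A Q B C D A' Q' B' C' D'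
        using that by (auto intro!: derivative_eq_intros simp: algebra_simps)
      show ?thesis
        using comb[OF dl1 dq dl2 das dl3] unfolding q_def .
    qed
    \<comment> \<open>Multiplying by the conjugate t q - c s brings all non-logarithmic terms over
      the denominator q (t^2 - s^2), where they cancel.\<close>
    have "R\<^sup>2 * (t\<^sup>2 - s\<^sup>2) = (t * q + c * s) * (t * q - c * s)"
      using sq by algebra
    then have inv: "1 / (t * q + c * s) = (t * q - c * s) / (R\<^sup>2 * (t\<^sup>2 - s\<^sup>2))"
      using nz \<open>0 < R\<close> by (simp add: field_simps)
    have "(t * (- s / q) + c) / (t * q + c * s) = (c * q - t * s) / q * (1 / (t * q + c * s))"
      using pos by (simp add: field_simps)
    also have "\<dots> = (c * q - t * s) * (t * q - c * s) / (q * (R\<^sup>2 * (t\<^sup>2 - s\<^sup>2)))"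
      unfolding inv by simp
    also have "(c * q - t * s) * (t * q - c * s) = R\<^sup>2 * (c * t - s * q)"
      using sq by algebra
    finally have 1: "(t * (- s / q) + c) / (t * q + c * s) = (c * t - s * q) / (q * (t\<^sup>2 - s\<^sup>2))"
      using \<open>0 < R\<close> by simp
    have 2: "1 / (t + s) = (t - s) / (t\<^sup>2 - s\<^sup>2)"
      using nz by (simp add: field_simps power2_eq_square)
    have "2 * c * ((c * t - s * q) / (q * (t\<^sup>2 - s\<^sup>2))) - 2 * q * ((t - s) / (t\<^sup>2 - s\<^sup>2))
      + 2 * t * (1 / q) + (q - c) * (- 2 * s / (t\<^sup>2 - s\<^sup>2))
      = (2 * c * (c * t - s * q) - 2 * q * q * (t - s) + 2 * t * (t\<^sup>2 - s\<^sup>2) - 2 * s * q * (q - c))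
        / (q * (t\<^sup>2 - s\<^sup>2))"
    proof -
      have "2 * c * (X / (q * z)) - 2 * q * (Y / z) + 2 * t * (1 / q) + (q - c) * (- 2 * s / z)
          = (2 * c * X - 2 * q * q * Y + 2 * t * z - 2 * s * q * (q - c)) / (q * z)"
        if "z \<noteq> 0" for X Y z
        using that pos by (simp add: field_simps)
      then show ?thesis using nz by blast
    qed
    also have "2 * c * (c * t - s * q) - 2 * q * q * (t - s) + 2 * t * (t\<^sup>2 - s\<^sup>2) - 2 * s * q * (q - c) = 0"
      using sq by algebra
    finally have 3: "2 * c * ((c * t - s * q) / (q * (t\<^sup>2 - s\<^sup>2))) - 2 * q * ((t - s) / (t\<^sup>2 - s\<^sup>2))
      + 2 * t * (1 / q) + (q - c) * (- 2 * s / (t\<^sup>2 - s\<^sup>2)) = 0" by simp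
    have "\<bar>(s + t) / (s - t)\<bar> = (t + s)\<^sup>2 / \<bar>t\<^sup>2 - s\<^sup>2\<bar>"
    proof -
      have "\<bar>t\<^sup>2 - s\<^sup>2\<bar> = (t + s) * \<bar>s - t\<bar>"
        using assms by (simp add: power2_eq_square square_diff_square_factored abs_mult abs_minus_commute)
      then show ?thesis using assms by (simp add: power2_eq_square add.commute)
    qed
    then have 4: "ln \<bar>(s + t) / (s - t)\<bar> = 2 * ln (t + s) - ln \<bar>t\<^sup>2 - s\<^sup>2\<bar>"
      using nz assms by (simp add: ln_div ln_realpow)
    have "2 * c * ((t * (- s / q) + c) / (t * q + c * s))
      - (2 * (- s / q) * ln (t + s) + 2 * q * (1 / (t + s)))
      + 2 * t * (1 / q) + ((- s / q) * ln \<bar>t\<^sup>2 - s\<^sup>2\<bar> + (q - c) * (- 2 * s / (t\<^sup>2 - s\<^sup>2)))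
      = s / q * (2 * ln (t + s) - ln \<bar>t\<^sup>2 - s\<^sup>2\<bar>)"
      unfolding 1 2 using 3 by (simp add: algebra_simps)
    then show "2 * c * ((t * (- s / q) + c) / (t * q + c * s))
      - (2 * (- s / q) * ln (t + s) + 2 * q * (1 / (t + s)))
      + 2 * t * (1 / q) + ((- s / q) * ln \<bar>t\<^sup>2 - s\<^sup>2\<bar> + (q - c) * (- 2 * s / (t\<^sup>2 - s\<^sup>2)))
      = s / sqrt (R\<^sup>2 - s\<^sup>2) * ln \<bar>(s + t) / (s - t)\<bar>"
      by (simp only: 4 q_def)
  qed
qed

text \<open>The value is linear in t and free of R, so integrating a sum of kernels against this
  weight returns the sum of their singularities. The fundamental theorem is applied across s = t,
  where the integrand is singular but the antiderivative is continuous.\<close>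

lemma arcsine_log_has_integral:
  fixes t R :: real
  assumes "0 < t" "t < R"
  shows "((\<lambda>s. s / sqrt (R\<^sup>2 - s\<^sup>2) * ln \<bar>(s + t) / (s - t)\<bar>) has_integral pi * t) {0..R}"
proof -
  define c where "c = sqrt (R\<^sup>2 - t\<^sup>2)"
  define F where "F s = 2 * c * ln (t * sqrt (R\<^sup>2 - s\<^sup>2) + c * s) - 2 * sqrt (R\<^sup>2 - s\<^sup>2) * ln (t + s)
      + 2 * t * arcsin (s / R) + (sqrt (R\<^sup>2 - s\<^sup>2) - c) * ln \<bar>t\<^sup>2 - s\<^sup>2\<bar>" for s
  have "t\<^sup>2 < R\<^sup>2" using assms by (auto intro: power_strict_mono)
  then have c: "0 < c" "c\<^sup>2 = R\<^sup>2 - t\<^sup>2" by (auto simp: c_def)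
  have "0 < R" using assms by simp
  have "((\<lambda>s. s / sqrt (R\<^sup>2 - s\<^sup>2) * ln \<bar>(s + t) / (s - t)\<bar>) has_integral (F R - F 0)) {0..R}"
  proof (rule fundamental_theorem_of_calculus_interior_strong[where S = "{t}"])
    show "(F has_vector_derivative s / sqrt (R\<^sup>2 - s\<^sup>2) * ln \<bar>(s + t) / (s - t)\<bar>) (at s)"
      if "s \<in> {0<..<R} - {t}" for s
      using arcsine_log_antiderivative[of t R s] assms that
      unfolding has_real_derivative_iff_has_vector_derivative[symmetric] F_def c_def by simp
    show "continuous_on {0..R} F"
    proof -
      have 1: "t * sqrt (R\<^sup>2 - s\<^sup>2) + c * s \<noteq> 0" if "s \<in> {0..R}" for s
      proof (cases "s = 0")
        case False
        then have "0 < c * s" "0 \<le> t * sqrt (R\<^sup>2 - s\<^sup>2)"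
          using that c assms by (auto simp: power_mono)
        then show ?thesis by simp
      qed (use assms in auto)
      \<comment> \<open>Since sqrt(R^2 - s^2) - c = (t^2 - s^2)/(sqrt(R^2 - s^2) + c), the product
        is z ln |z| divided by a positive function.\<close>
      have 2: "continuous_on {0..R} (\<lambda>s. (sqrt (R\<^sup>2 - s\<^sup>2) - c) * ln \<bar>t\<^sup>2 - s\<^sup>2\<bar>)"
      proof (rule continuous_on_eq)
        have cancel: "X * l / b = a * l" if "X = a * b" "b \<noteq> 0" for X l a b :: real
          using that by simp
        have nz: "sqrt (R\<^sup>2 - s\<^sup>2) + c \<noteq> 0" if "s \<in> {0..R}" for s
        proof -
          have "0 \<le> sqrt (R\<^sup>2 - s\<^sup>2)" using that by (simp add: power_mono)
          then show ?thesis using c(1) by linarith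
        qed
        show "continuous_on {0..R} (\<lambda>s. ((t\<^sup>2 - s\<^sup>2) * ln \<bar>t\<^sup>2 - s\<^sup>2\<bar>) / (sqrt (R\<^sup>2 - s\<^sup>2) + c))"
          using nz
          by (intro continuous_intros continuous_on_compose2[OF continuous_mult_ln_abs]) auto
        fix s assume s: "s \<in> {0..R}"
        have "(sqrt (R\<^sup>2 - s\<^sup>2))\<^sup>2 = R\<^sup>2 - s\<^sup>2" using s by (simp add: power_mono)
        then have "t\<^sup>2 - s\<^sup>2 = (sqrt (R\<^sup>2 - s\<^sup>2) - c) * (sqrt (R\<^sup>2 - s\<^sup>2) + c)"
          using c(2) by algebra
        then show "(t\<^sup>2 - s\<^sup>2) * ln \<bar>t\<^sup>2 - s\<^sup>2\<bar> / (sqrt (R\<^sup>2 - s\<^sup>2) + c)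
            = (sqrt (R\<^sup>2 - s\<^sup>2) - c) * ln \<bar>t\<^sup>2 - s\<^sup>2\<bar>"
          by (rule cancel) (rule nz[OF s])
      qed
      have 3: "continuous_on {0..R} (\<lambda>s. 2 * c * ln (t * sqrt (R\<^sup>2 - s\<^sup>2) + c * s))"
        using 1 by (intro continuous_intros) auto
      have 4: "continuous_on {0..R} (\<lambda>s. 2 * sqrt (R\<^sup>2 - s\<^sup>2) * ln (t + s))"
        using assms by (intro continuous_intros) auto
      have "-1 \<le> s / R \<and> s / R \<le> 1" if "s \<in> {0..R}" for s
      proof -
        have "0 \<le> s / R" "s / R \<le> 1" using that \<open>0 < R\<close> by auto
        then show ?thesis by linarith
      qed
      then have 5: "continuous_on {0..R} (\<lambda>s. 2 * t * arcsin (s / R))"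
        using \<open>0 < R\<close> by (intro continuous_intros) auto
      show ?thesis unfolding F_def
        by (rule continuous_on_add[OF continuous_on_add[OF continuous_on_diff[OF 3 4] 5] 2])
    qed
  qed (use assms in auto)
  also have "F R - F 0 = pi * t"
  proof -
    \<comment> \<open>All logarithms cancel between the endpoints; what remains is 2 t arcsin 1 = pi
      t.\<close>
    have "F R = 2 * c * (ln c + ln R) + pi * t - c * ln (c\<^sup>2)"
      using \<open>0 < R\<close> c \<open>t\<^sup>2 < R\<^sup>2\<close> by (simp add: F_def ln_mult)
    moreover have "F 0 = 2 * c * (ln t + ln R) - 2 * R * ln t + (R - c) * ln (t\<^sup>2)"
      using assms by (simp add: F_def ln_mult)
    ultimately show ?thesis
      using c(1) assms by (simp add: ln_realpow algebra_simps)
  qed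
  finally show ?thesis .
qed

text \<open>The measure t dt / sqrt(R^2 - t^2) in the coordinate u = ln t; one factor
  \<open>exp u\<close> is the Jacobian.\<close>

definition arcsine_weight :: "real \<Rightarrow> real \<Rightarrow> real" where
  "arcsine_weight R u = exp (2 * u) / sqrt (R\<^sup>2 - exp (2 * u))"

lemma exp_image_lessThan_ln:
  assumes "0 < R"
  shows "exp ` {..<ln R} = {0<..<R::real}"
proof -
  have "y \<in> exp ` {..<ln R}" if "0 < y" "y < R" for y
    using that by (intro image_eqI[of _ _ "ln y"]) auto
  then show ?thesis using assms exp_less_cancel_iff[of _ "ln R"] by auto
qed

lemma exp_two_mult: "exp (2 * u) = exp u * exp (u::real)"
  by (simp flip: exp_add)

lemma arcsine_weight_nonneg:
  assumes "u < ln R" "0 < R"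
  shows "0 \<le> arcsine_weight R u"
proof -
  have "exp u < R" using assms exp_less_cancel_iff[of u "ln R"] by simp
  then have "exp u * exp u \<le> R * R" using assms by (intro mult_mono) auto
  then show ?thesis by (simp add: arcsine_weight_def exp_two_mult power2_eq_square)
qed

lemma arcsine_weight_log_coth_has_integral:
  assumes "0 < R" "a < ln R"
  shows "((\<lambda>u. arcsine_weight R u * log_coth (u - a)) has_integral pi * exp a) {..<ln R}"
proof -
  let ?f = "\<lambda>s. s / sqrt (R\<^sup>2 - s\<^sup>2) * ln \<bar>(s + exp a) / (s - exp a)\<bar>"
  have eq: "\<bar>exp u\<bar> * ?f (exp u) = arcsine_weight R u * log_coth (u - a)" for u
  proof -
    have "(exp u + exp a) / (exp u - exp a) = (exp (u - a) + 1) / (exp (u - a) - 1)"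
      by (simp add: exp_diff divide_simps)
    then show ?thesis
      by (simp add: arcsine_weight_def log_coth_def exp_two_mult power2_eq_square)
  qed
  have "((\<lambda>u. \<bar>exp u\<bar> * ?f (exp u)) has_integral pi * exp a) {..<ln R}"
  proof (rule has_integral_substitution_nonneg[where g = exp])
    have "exp a < R" using assms exp_less_cancel_iff[of a "ln R"] by simp
    then show "(?f has_integral pi * exp a) (exp ` {..<ln R})"
      using arcsine_log_has_integral[of "exp a" R] assms
      by (simp add: exp_image_lessThan_ln has_integral_Icc_iff_Ioo)
    show "0 \<le> ?f (exp u)" if "u \<in> {..<ln R}" for u
    proof -
      have "0 \<le> \<bar>exp u\<bar> * ?f (exp u)"
        unfolding eq using that assms by (auto intro!: mult_nonneg_nonneg arcsine_weight_nonneg log_coth_nonneg)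
      then show ?thesis by (subst (asm) zero_le_mult_iff) auto
    qed
  qed (auto intro!: derivative_eq_intros simp: inj_on_def)
  then show ?thesis unfolding eq .
qed

text \<open>\<open>S\<close> is described through its image under \<open>exp\<close>, so that one
  statement covers both the half line below ln R (with d = 0) and the interval from ln d to 0 (with
  R = 1).\<close>

lemma arcsine_weight_has_integral:
  assumes "0 \<le> d" "d < R" and im: "exp ` S = {d<..<R}" and S: "S \<in> sets lebesgue"
  shows "(arcsine_weight R has_integral sqrt (R\<^sup>2 - d\<^sup>2)) S"
proof -
  let ?f = "\<lambda>s. s / sqrt (R\<^sup>2 - s\<^sup>2)"
  have "((\<lambda>u. \<bar>exp u\<bar> * ?f (exp u)) has_integral (- sqrt (R\<^sup>2 - R\<^sup>2) - (- sqrt (R\<^sup>2 - d\<^sup>2)))) (S)"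
  proof (rule has_integral_substitution_nonneg[where g = exp])
    have "(?f has_integral (- sqrt (R\<^sup>2 - R\<^sup>2) - (- sqrt (R\<^sup>2 - d\<^sup>2)))) {d..R}"
    proof (rule fundamental_theorem_of_calculus_interior)
      fix s assume s: "s \<in> {d<..<R}"
      then have "s\<^sup>2 < R\<^sup>2" using assms by (auto intro: power_strict_mono)
      then show "((\<lambda>s. - sqrt (R\<^sup>2 - s\<^sup>2)) has_vector_derivative s / sqrt (R\<^sup>2 - s\<^sup>2)) (at s)"
        unfolding has_real_derivative_iff_has_vector_derivative[symmetric]
        by (auto intro!: derivative_eq_intros simp: field_simps)
    qed (use assms in \<open>auto intro!: continuous_intros\<close>)
    then show "(?f has_integral (- sqrt (R\<^sup>2 - R\<^sup>2) - (- sqrt (R\<^sup>2 - d\<^sup>2)))) (exp ` S)"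
      unfolding im by (simp only: has_integral_Icc_iff_Ioo)
    show "0 \<le> ?f (exp u)" if "u \<in> S" for u
    proof -
      have "exp u \<in> {d<..<R}" using that im by blast
      then show ?thesis using assms by (auto simp: power_mono)
    qed
  qed (use S in \<open>auto intro!: derivative_eq_intros simp: inj_on_def\<close>)
  then show ?thesis
    by (simp add: arcsine_weight_def[abs_def] exp_two_mult power2_eq_square)
qed

section \<open>Potentials with interlacing extremal points\<close>

lemma exp_has_integral_atMost:
  assumes "0 < c"
  shows "((\<lambda>u::real. exp (c * u)) has_integral exp (c * b) / c) {..b}"
proof -
  have "((\<lambda>u. \<bar>-1\<bar> * exp (- c * (- u))) has_integral exp (- c * (- b)) / c) {..b}"
  proof (rule has_integral_substitution_nonneg[where g = uminus])
    show "((\<lambda>x. exp (- c * x)) has_integral exp (- c * (- b)) / c) (uminus ` {..b})"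
      using has_integral_exp_minus_to_infinity[OF assms, of "- b"] by simp
  qed (auto intro!: derivative_eq_intros)
  then show ?thesis by simp
qed

text \<open>A majorant for the logarithmic spikes: the excess of the potential near a zero is at
  most four times the square root of this bump. The bump itself is integrable, with mass
  proportional to its radius d, so even the square of the excess can be integrated.\<close>

definition sqrt_bump :: "real \<Rightarrow> real \<Rightarrow> real \<Rightarrow> real" where
  "sqrt_bump a d u = (if \<bar>u - a\<bar> \<le> d then sqrt (d / \<bar>u - a\<bar>) else 0)"

lemma sqrt_bump_nonneg: "0 \<le> sqrt_bump a d u"
proof (cases "\<bar>u - a\<bar> \<le> d")
  case True
  then have "0 \<le> d / \<bar>u - a\<bar>" by (intro divide_nonneg_nonneg) auto
  then show ?thesis by (simp add: sqrt_bump_def)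
qed (simp add: sqrt_bump_def)

lemma sqrt_bump_has_integral:
  assumes "0 \<le> d"
  shows "(sqrt_bump a d has_integral 4 * d) UNIV"
proof -
  have *: "((\<lambda>u. sqrt (d / \<bar>u - a\<bar>)) has_integral
      (2 * sqrt d * sqrt (a + d - a) - 2 * sqrt d * sqrt (a - d - a))) {a - d..a + d}"
  proof (rule fundamental_theorem_of_calculus_interior_strong[where S = "{a}"])
    fix u assume u: "u \<in> {a - d<..<a + d} - {a}"
    then have "0 < d" by auto
    \<comment> \<open>\<open>sqrt\<close> is extended to negative arguments as an odd function, so
      one antiderivative serves on both sides of a.\<close>
    show "((\<lambda>u. 2 * sqrt d * sqrt (u - a)) has_vector_derivative sqrt (d / \<bar>u - a\<bar>)) (at u)"
      unfolding has_real_derivative_iff_has_vector_derivative[symmetric]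
    proof (cases "u < a")
      case True
      have "((\<lambda>u. 2 * sqrt d * (- sqrt (a - u))) has_real_derivative sqrt (d / \<bar>u - a\<bar>)) (at u)"
        using True \<open>0 < d\<close> by (auto intro!: derivative_eq_intros simp: real_sqrt_divide field_simps)
      then show "((\<lambda>u. 2 * sqrt d * sqrt (u - a)) has_real_derivative sqrt (d / \<bar>u - a\<bar>)) (at u)"
        by (simp flip: real_sqrt_minus)
    next
      case False
      then show "((\<lambda>u. 2 * sqrt d * sqrt (u - a)) has_real_derivative sqrt (d / \<bar>u - a\<bar>)) (at u)"
        using u \<open>0 < d\<close> by (auto intro!: derivative_eq_intros simp: real_sqrt_divide field_simps)
    qed
  qed (use assms in \<open>auto intro!: continuous_intros\<close>)
  have "2 * sqrt d * sqrt (a + d - a) - 2 * sqrt d * sqrt (a - d - a) = 4 * d"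
    using assms by (simp add: real_sqrt_minus)
  with * have "((\<lambda>u. if u \<in> {a - d..a + d} then sqrt (d / \<bar>u - a\<bar>) else 0) has_integral 4 * d) UNIV"
    by (simp only: has_integral_restrict_UNIV)
  moreover have "(\<lambda>u. if u \<in> {a - d..a + d} then sqrt (d / \<bar>u - a\<bar>) else 0) = sqrt_bump a d"
    by (auto simp: sqrt_bump_def fun_eq_iff)
  ultimately show ?thesis by simp
qed

lemma convex_on_log_coth_shift:
  assumes "convex S" "(\<forall>u\<in>S. a < u) \<or> (\<forall>u\<in>S. u < a)"
  shows "convex_on S (\<lambda>u. log_coth (u - a))"
proof (rule convex_onI)
  fix t x y :: real assume t: "0 < t" "t < 1" and xy: "x \<in> S" "y \<in> S"
  show "log_coth ((1 - t) *\<^sub>R x + t *\<^sub>R y - a) \<le> (1 - t) * log_coth (x - a) + t * log_coth (y - a)"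
    using assms(2)
  proof
    assume "\<forall>u\<in>S. a < u"
    then have "log_coth ((1 - t) *\<^sub>R (x - a) + t *\<^sub>R (y - a))
        \<le> (1 - t) * log_coth (x - a) + t * log_coth (y - a)"
      using xy t by (intro convex_onD[OF log_coth_convex]) auto
    then show ?thesis by (simp add: algebra_simps)
  next
    assume "\<forall>u\<in>S. u < a"
    then have "log_coth ((1 - t) *\<^sub>R (a - x) + t *\<^sub>R (a - y))
        \<le> (1 - t) * log_coth (a - x) + t * log_coth (a - y)"
      using xy t by (intro convex_onD[OF log_coth_convex]) auto
    moreover have "(1 - t) *\<^sub>R (a - x) + t *\<^sub>R (a - y) = - ((1 - t) *\<^sub>R x + t *\<^sub>R y - a)"
      by (simp add: algebra_simps)
    ultimately show ?thesis
      using log_coth_minus[of "x - a"] log_coth_minus[of "y - a"]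
        log_coth_minus[of "(1 - t) *\<^sub>R x + t *\<^sub>R y - a"] by simp
  qed
qed fact

text \<open>The fourth root makes the bound square-integrable near a spike: at y = d/|u - a| its
  square is a multiple of \<open>sqrt_bump\<close>.\<close>

lemma ln_le_four_fourth_root:
  assumes "0 < y"
  shows "ln y \<le> 4 * sqrt (sqrt (y::real))"
proof -
  have "ln (sqrt (sqrt y)) \<le> sqrt (sqrt y)"
    using ln_less_self[of "sqrt (sqrt y)"] assms by (simp only: less_imp_le real_sqrt_gt_zero)
  then show ?thesis using assms by (simp add: ln_sqrt)
qed

definition log_potential :: "nat \<Rightarrow> (nat \<Rightarrow> real) \<Rightarrow> real \<Rightarrow> real" where
  "log_potential n a u = (\<Sum>i<n. log_coth (u - a i))"

text \<open>The data of the best approximant in the coordinate u = ln t: the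
  \<open>exp (a i)\<close> are the zeros, L = -ln E, and \<open>y i\<close> is the logarithm of the
  extremal point following the i-th zero. The smallest extremal point, which may be 0, is left out,
  so no node lies below \<open>a 0\<close>. The constant ln 3 comes from |2t - e| <= 3t when |e| = E
  <= t.\<close>

locale equioscillating_potential =
  fixes n :: nat and a y :: "nat \<Rightarrow> real" and L :: real
  assumes n_pos: "0 < n"
    and zero_less_node: "i < n \<Longrightarrow> a i < y i"
    and node_less_zero: "Suc i < n \<Longrightarrow> y i < a (Suc i)"
    and node_ge: "- L \<le> y 0"
    and node_le: "y (n - 1) \<le> 0"
    and potential_ge: "u \<in> {- L..0} \<Longrightarrow> u \<notin> a ` {..<n} \<Longrightarrow> u + L \<le> log_potential n a u"
    and potential_node_le: "i < n \<Longrightarrow> log_potential n a (y i) \<le> y i + L + ln 3"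
begin

section \<open>Pointwise bounds from interlacing\<close>

lemma node_mono: "i \<le> j \<Longrightarrow> j < n \<Longrightarrow> y i \<le> y j"
proof (induction j)
  case (Suc j)
  show ?case
  proof (cases "i = Suc j")
    case False
    then have "y i \<le> y j" using Suc by simp
    moreover have "y j < a (Suc j)" "a (Suc j) < y (Suc j)"
      using Suc node_less_zero zero_less_node by auto
    ultimately show ?thesis by linarith
  qed simp
qed simp

lemma zero_less_node': "i \<le> j \<Longrightarrow> j < n \<Longrightarrow> a i < y j"
  using zero_less_node[of i] node_mono[of i j] by linarith

lemma node_less_zero': "j < i \<Longrightarrow> i < n \<Longrightarrow> y j < a i"
  using node_less_zero[of "i - 1"] node_mono[of j "i - 1"] by force

lemma node_bounds: "i < n \<Longrightarrow> - L \<le> y i \<and> y i \<le> 0"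
  using node_mono[of 0 i] node_mono[of i "n - 1"] node_ge node_le by force

lemma zero_neg: "i < n \<Longrightarrow> a i < 0"
  using zero_less_node[of i] node_bounds[of i] by linarith

lemma L_nonneg: "0 \<le> L"
  using node_bounds[OF n_pos] by linarith

lemma zeros_sum_le: "sum f {..<n} \<le> f 0 + sum f {1..<n}" for f :: "nat \<Rightarrow> real"
  using n_pos by (simp add: sum.atLeast_Suc_lessThan lessThan_atLeast0)

text \<open>All zeros lie to the left of the last node, so every summand decays exponentially beyond
  it.\<close>

lemma potential_le_right:
  assumes "y (n - 1) \<le> u"
  shows "log_potential n a u \<le> exp (y (n - 1) - u) * (L + ln 3)"
proof -
  let ?y = "y (n - 1)"
  have "log_potential n a u \<le> (\<Sum>i<n. exp (?y - u) * log_coth (?y - a i))"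
    unfolding log_potential_def
  proof (rule sum_mono)
    fix i assume "i \<in> {..<n}"
    then have "a i < ?y" using zero_less_node'[of i "n - 1"] by simp
    then show "log_coth (u - a i) \<le> exp (?y - u) * log_coth (?y - a i)"
      using log_coth_exp_decay[of "?y - a i" "u - a i"] assms by simp
  qed
  also have "\<dots> = exp (?y - u) * log_potential n a ?y"
    by (simp add: log_potential_def sum_distrib_left)
  also have "\<dots> \<le> exp (?y - u) * (L + ln 3)"
    using potential_node_le[of "n - 1"] node_bounds[of "n - 1"] n_pos by (intro mult_left_mono) auto
  finally show ?thesis .
qed

text \<open>The zero \<open>a 0\<close> lies on the same side of \<open>y 0\<close> as u, so its
  term is kept as it is. Every other zero lies to the right of \<open>y 0\<close>, and its term
  decays as u moves left.\<close>

lemma potential_le_left: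
  assumes "u \<le> y 0"
  shows "log_potential n a u \<le> log_coth (u - a 0) + exp (u - y 0) * (L + ln 3)"
proof -
  have "(\<Sum>i\<in>{1..<n}. log_coth (u - a i)) \<le> (\<Sum>i\<in>{1..<n}. exp (u - y 0) * log_coth (y 0 - a i))"
  proof (rule sum_mono)
    fix i assume "i \<in> {1..<n}"
    then have "y 0 < a i" using node_less_zero'[of 0 i] by simp
    then show "log_coth (u - a i) \<le> exp (u - y 0) * log_coth (y 0 - a i)"
      using log_coth_exp_decay[of "a i - y 0" "a i - u"] assms
        log_coth_minus[of "u - a i"] log_coth_minus[of "y 0 - a i"] by simp
  qed
  also have "\<dots> = exp (u - y 0) * (\<Sum>i\<in>{1..<n}. log_coth (y 0 - a i))"
    by (simp add: sum_distrib_left)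
  also have "\<dots> \<le> exp (u - y 0) * log_potential n a (y 0)"
    unfolding log_potential_def
    by (intro mult_left_mono sum_mono2) (auto simp: log_coth_nonneg)
  also have "\<dots> \<le> exp (u - y 0) * (L + ln 3)"
    using potential_node_le[of 0] node_bounds[of 0] n_pos by (intro mult_left_mono) auto
  finally show ?thesis
    using zeros_sum_le[of "\<lambda>i. log_coth (u - a i)"] by (simp add: log_potential_def)
qed

text \<open>One bump for each zero between two nodes, with the node gap as radius. The masses
  telescope, so the total is at most 4 L however many zeros there are.\<close>

definition bump_sum :: "real \<Rightarrow> real" where
  "bump_sum u = (\<Sum>i<n - 1. sqrt_bump (a (Suc i)) (y (Suc i) - y i) u)"

lemma bump_sum_nonneg: "0 \<le> bump_sum u"
  by (auto simp: bump_sum_def intro!: sum_nonneg sqrt_bump_nonneg)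

lemma bump_sum_has_integral: "(bump_sum has_integral 4 * (y (n - 1) - y 0)) UNIV"
proof -
  have "((\<lambda>u. \<Sum>i<n - 1. sqrt_bump (a (Suc i)) (y (Suc i) - y i) u) has_integral
      (\<Sum>i<n - 1. 4 * (y (Suc i) - y i))) UNIV"
  proof (rule has_integral_sum)
    show "(sqrt_bump (a (Suc i)) (y (Suc i) - y i) has_integral 4 * (y (Suc i) - y i)) UNIV"
      if "i \<in> {..<n - 1}" for i
      using that node_mono[of i "Suc i"] by (intro sqrt_bump_has_integral) auto
  qed simp
  moreover have "(\<Sum>i<n - 1. 4 * (y (Suc i) - y i)) = 4 * (y (n - 1) - y 0)"
    by (subst sum_distrib_left[symmetric]) (simp only: sum_lessThan_telescope)
  ultimately show ?thesis
    by (simp only: bump_sum_def[abs_def])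
qed

text \<open>With the single zero between the two nodes removed, the remaining sum is convex on the
  gap, so an affine bound at the two nodes holds throughout. The removed kernel returns as the
  spike.\<close>

lemma potential_le_between:
  assumes "Suc i < n" "y i \<le> u" "u \<le> y (Suc i)"
  defines "d \<equiv> y (Suc i) - y i"
  shows "log_potential n a u \<le> u + L + ln 3 + 4 * sqrt (sqrt_bump (a (Suc i)) d u)"
proof -
  let ?b = "a (Suc i)"
  let ?K = "{..<n} - {Suc i}"
  let ?S = "{y i..y (Suc i)}"
  have b: "y i < ?b" "?b < y (Suc i)" using assms node_less_zero zero_less_node by auto
  then have "0 < d" by (simp add: d_def)
  have split: "log_potential n a v = log_coth (v - ?b) + (\<Sum>k\<in>?K. log_coth (v - a k))" for v
    unfolding log_potential_def using assms by (intro sum.remove) auto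
  \<comment> \<open>Both nodes are within distance d of the zero, so the removed kernel is at least
    \<open>log_coth d\<close> there; removing it lowers the bound at the ends by this
    constant.\<close>
  have end_le: "(\<Sum>k\<in>?K. log_coth (v - a k)) \<le> v + L + ln 3 - log_coth d"
    if "v = y i \<or> v = y (Suc i)" for v
  proof -
    have "log_coth d \<le> log_coth \<bar>v - ?b\<bar>"
      using that b by (intro log_coth_antimono) (auto simp: d_def)
    then have "log_coth d \<le> log_coth (v - ?b)" by (simp only: log_coth_abs)
    moreover have "log_potential n a v \<le> v + L + ln 3"
      using that assms potential_node_le by auto
    ultimately show ?thesis using split[of v] by linarith
  qed
  define t where "t = (u - y i) / d"
  have t: "0 \<le> t" "t \<le> 1" "(1 - t) * y i + t * y (Suc i) = u"
  proof -
    show "0 \<le> t" "t \<le> 1" using assms \<open>0 < d\<close> by (auto simp: t_def d_def)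
    have "t * d = u - y i" using \<open>0 < d\<close> by (simp add: t_def)
    then show "(1 - t) * y i + t * y (Suc i) = u" by (simp add: d_def algebra_simps)
  qed
  have "(\<Sum>k\<in>?K. log_coth (u - a k))
      \<le> (\<Sum>k\<in>?K. (1 - t) * log_coth (y i - a k) + t * log_coth (y (Suc i) - a k))"
  proof (rule sum_mono)
    fix k assume k: "k \<in> ?K"
    have "convex_on ?S (\<lambda>u. log_coth (u - a k))"
    proof (rule convex_on_log_coth_shift)
      show "(\<forall>u\<in>?S. a k < u) \<or> (\<forall>u\<in>?S. u < a k)"
        using k assms zero_less_node'[of k i] node_less_zero'[of "Suc i" k]
        by (cases "k \<le> i") force+
    qed simp
    from convex_onD[OF this t(1,2), of "y i" "y (Suc i)"]
    show "log_coth (u - a k) \<le> (1 - t) * log_coth (y i - a k) + t * log_coth (y (Suc i) - a k)"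
      using assms t by simp
  qed
  also have "\<dots> = (1 - t) * (\<Sum>k\<in>?K. log_coth (y i - a k)) + t * (\<Sum>k\<in>?K. log_coth (y (Suc i) - a k))"
    by (simp add: sum.distrib sum_distrib_left)
  also have "\<dots> \<le> (1 - t) * (y i + L + ln 3 - log_coth d) + t * (y (Suc i) + L + ln 3 - log_coth d)"
    using t by (intro add_mono mult_left_mono end_le) auto
  also have "\<dots> = u + L + ln 3 - log_coth d"
    using t(3) by (simp add: algebra_simps)
  finally have "log_potential n a u \<le> u + L + ln 3 + (log_coth (u - ?b) - log_coth d)"
    using split[of u] by linarith
  \<comment> \<open>After this subtraction only ln(d/|u - ?b|) is left of the removed kernel. At the
    zero itself the left side is nonpositive, because \<open>log_coth 0\<close> is 0.\<close>
  moreover have "log_coth (u - ?b) - log_coth d \<le> 4 * sqrt (sqrt_bump ?b d u)"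
  proof (cases "u = ?b")
    case True
    then show ?thesis
      using log_coth_nonneg[of d] real_sqrt_ge_zero[OF sqrt_bump_nonneg[of ?b d u]]
      by (simp del: real_sqrt_ge_0_iff)
  next
    case False
    have le: "\<bar>u - ?b\<bar> \<le> d" using assms b by (auto simp: d_def)
    have "log_coth \<bar>u - ?b\<bar> - log_coth d \<le> ln (d / \<bar>u - ?b\<bar>)"
      using False le by (intro log_coth_diff_le) auto
    also have "\<dots> \<le> 4 * sqrt (sqrt (d / \<bar>u - ?b\<bar>))"
      using False \<open>0 < d\<close> by (intro ln_le_four_fourth_root) auto
    finally show ?thesis using le by (simp add: sqrt_bump_def log_coth_abs)
  qed
  ultimately show ?thesis by simp
qed

lemma between_nodes:
  assumes "m < n" "y 0 < u" "u \<le> y m"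
  shows "\<exists>i<m. y i \<le> u \<and> u \<le> y (Suc i)"
  using assms
proof (induction m)
  case (Suc m)
  then show ?case by (cases "u \<le> y m") (auto intro: less_SucI)
qed auto

lemma potential_le_inside:
  assumes "y 0 \<le> u" "u \<le> y (n - 1)"
  shows "log_potential n a u \<le> u + L + ln 3 + 4 * sqrt (bump_sum u)"
proof (cases "u = y 0")
  case True
  then show ?thesis
    using potential_node_le[OF n_pos] real_sqrt_ge_zero[OF bump_sum_nonneg[of u]]
    by (simp del: real_sqrt_ge_0_iff)
next
  case False
  then obtain i where i: "i < n - 1" "y i \<le> u" "u \<le> y (Suc i)"
    using between_nodes[of "n - 1" u] assms n_pos by auto
  have "sqrt_bump (a (Suc i)) (y (Suc i) - y i) u \<le> bump_sum u"
    unfolding bump_sum_def using i by (intro member_le_sum) (auto simp: sqrt_bump_nonneg)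
  then have "sqrt (sqrt_bump (a (Suc i)) (y (Suc i) - y i) u) \<le> sqrt (bump_sum u)" by simp
  then show ?thesis
    using potential_le_between[of i u] i by (simp del: real_sqrt_le_iff) linarith
qed

section \<open>The mass of the potential and the size of L\<close>

lemma potential_has_integral: "(log_potential n a has_integral real n * (pi\<^sup>2 / 2)) UNIV"
proof -
  have "((\<lambda>u. \<Sum>i<n. log_coth (u - a i)) has_integral (\<Sum>i<n. pi\<^sup>2 / 2)) UNIV"
    by (intro has_integral_sum log_coth_shift_has_integral) simp
  then show ?thesis by (simp add: log_potential_def[abs_def])
qed

lemma affine_has_integral:
  "((\<lambda>u. if u \<in> {- L..0} then u + L + c else 0) has_integral L\<^sup>2 / 2 + c * L) UNIV"
proof -
  have "((\<lambda>u. u + L + c) has_integral ((0 + L + c)\<^sup>2 / 2 - (- L + L + c)\<^sup>2 / 2)) {- L..0}"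
  proof (rule fundamental_theorem_of_calculus)
    show "((\<lambda>u. (u + L + c)\<^sup>2 / 2) has_vector_derivative u + L + c) (at u within {- L..0})" for u
      unfolding has_real_derivative_iff_has_vector_derivative[symmetric]
      by (auto intro!: derivative_eq_intros)
  qed (use L_nonneg in simp)
  moreover have "(0 + L + c)\<^sup>2 / 2 - (- L + L + c)\<^sup>2 / 2 = L\<^sup>2 / 2 + c * L"
    by (simp add: power2_eq_square field_simps)
  ultimately show ?thesis by (simp only: has_integral_restrict_UNIV)
qed

lemma L_upper: "L\<^sup>2 \<le> real n * pi\<^sup>2"
proof -
  have "L\<^sup>2 / 2 + 0 * L \<le> real n * (pi\<^sup>2 / 2)"
  proof (rule has_integral_le)
    \<comment> \<open>The minorant is set to 0 at the finitely many zeros, where the convention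
      \<open>log_coth 0 = 0\<close> spoils the lower bound; the integral does not change.\<close>
    show "((\<lambda>u. if u \<in> a ` {..<n} then 0 else if u \<in> {- L..0} then u + L + 0 else 0)
        has_integral L\<^sup>2 / 2 + 0 * L) UNIV"
      by (rule has_integral_spike_finite[OF _ _ affine_has_integral, where S = "a ` {..<n}"]) auto
    show "(if u \<in> a ` {..<n} then 0 else if u \<in> {- L..0} then u + L + 0 else 0) \<le> log_potential n a u" for u
    proof -
      have "0 \<le> log_potential n a u" by (auto simp: log_potential_def log_coth_nonneg intro!: sum_nonneg)
      then show ?thesis using potential_ge[of u] by auto
    qed
  qed (rule potential_has_integral)
  then show ?thesis by simp
qed

lemma L_lower: "real n * pi\<^sup>2 \<le> L\<^sup>2 + 42 * L + pi\<^sup>2 + 8"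
proof -
  \<comment> \<open>The majorant adds the affine bound, the bumps, the kernel of the lowest zero and
    exponential tails on both sides. Each tail has mass L + ln 3.\<close>
  let ?A = "\<lambda>u. if u \<in> {- L..0} then u + L + (ln 3 + 1) else 0"
  let ?l = "\<lambda>u. if u \<in> {..y 0} then exp (1 * u) else 0"
  let ?r = "\<lambda>u. if u \<in> {y (n - 1)..} then exp (- 1 * u) else 0"
  let ?M = "\<lambda>u. ?A u + 4 * bump_sum u + log_coth (u - a 0)
      + (exp (- y 0) * (L + ln 3) * ?l u + exp (y (n - 1)) * (L + ln 3) * ?r u)"
  have "real n * (pi\<^sup>2 / 2) \<le> (L\<^sup>2 / 2 + (ln 3 + 1) * L) + 4 * (4 * (y (n - 1) - y 0)) + pi\<^sup>2 / 2
      + (exp (- y 0) * (L + ln 3) * (exp (1 * y 0) / 1)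
        + exp (y (n - 1)) * (L + ln 3) * (exp (- 1 * y (n - 1)) / 1))"
  proof (rule has_integral_le[OF potential_has_integral])
    show "(?M has_integral (L\<^sup>2 / 2 + (ln 3 + 1) * L) + 4 * (4 * (y (n - 1) - y 0)) + pi\<^sup>2 / 2
      + (exp (- y 0) * (L + ln 3) * (exp (1 * y 0) / 1)
        + exp (y (n - 1)) * (L + ln 3) * (exp (- 1 * y (n - 1)) / 1))) UNIV"
      by (intro has_integral_add affine_has_integral has_integral_mult_right bump_sum_has_integral
          log_coth_shift_has_integral has_integral_restrict_UNIV[THEN iffD2]
          exp_has_integral_atMost has_integral_exp_minus_to_infinity) auto
    fix u
    have "0 \<le> ?A u" "0 \<le> 4 * bump_sum u" "0 \<le> log_coth (u - a 0)"
      "0 \<le> exp (- y 0) * (L + ln 3) * ?l u" "0 \<le> exp (y (n - 1)) * (L + ln 3) * ?r u"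
      using L_nonneg by (auto simp: bump_sum_nonneg log_coth_nonneg)
    moreover consider "u \<le> y 0" | "y (n - 1) \<le> u" | "y 0 \<le> u" "u \<le> y (n - 1)" by linarith
    then have "log_potential n a u \<le> log_coth (u - a 0) + exp (- y 0) * (L + ln 3) * ?l u
      \<or> log_potential n a u \<le> exp (y (n - 1)) * (L + ln 3) * ?r u
      \<or> log_potential n a u \<le> ?A u + 4 * bump_sum u"
    proof cases
      case 1
      have "exp (u - y 0) = exp (- y 0) * exp (1 * u)" by (simp flip: exp_add)
      then show ?thesis using 1 potential_le_left[of u] by (simp add: mult_ac)
    next
      case 2
      have "exp (y (n - 1) - u) = exp (y (n - 1)) * exp (- 1 * u)" by (simp flip: exp_add)
      then show ?thesis using 2 potential_le_right[of u] by (simp add: mult_ac)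
    next
      case 3
      \<comment> \<open>This gives 4 sqrt b <= 4 b + 1, which accounts for the 1 next to ln 3 in
        \<open>?A\<close>.\<close>
      have "0 \<le> (2 * sqrt (bump_sum u) - 1)\<^sup>2" by simp
      then have "4 * sqrt (bump_sum u) \<le> 4 * bump_sum u + 1"
        using bump_sum_nonneg[of u] by (simp add: power2_diff power_mult_distrib)
      then show ?thesis
        using potential_le_inside[of u] 3 node_ge node_le by auto
    qed
    ultimately show "log_potential n a u \<le> ?M u" by argo
  qed
  also have "exp (- y 0) * (L + ln 3) * (exp (1 * y 0) / 1) = L + ln 3"
    by (simp add: exp_minus)
  also have "exp (y (n - 1)) * (L + ln 3) * (exp (- 1 * y (n - 1)) / 1) = L + ln 3"
    by (simp add: exp_minus)
  finally have "real n * (pi\<^sup>2 / 2) \<le> (L\<^sup>2 / 2 + (ln 3 + 1) * L) + 4 * (4 * (y (n - 1) - y 0)) + pi\<^sup>2 / 2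
      + (L + ln 3 + (L + ln 3))" .
  moreover have "y (n - 1) - y 0 \<le> L" using node_ge node_le by linarith
  ultimately have *: "real n * pi\<^sup>2 \<le> L\<^sup>2 + 2 * (ln 3 + 1) * L + 32 * L + pi\<^sup>2 + 4 * (L + ln 3)"
    by argo
  \<comment> \<open>With ln 3 <= 2 the additional linear terms are at most 6 L + 32 L + 4 L, and the
    constants at most pi^2 + 8.\<close>
  have "ln 3 \<le> (2::real)" using ln_le_minus_one[of 3] by simp
  moreover have "ln 3 * L \<le> 2 * L" using calculation L_nonneg by (intro mult_right_mono) auto
  ultimately show ?thesis using * by (simp add: algebra_simps)
qed

section \<open>The sum of the zeros\<close>

lemma arcsine_weight_potential_has_integral:
  assumes "1 \<le> R"
  shows "((\<lambda>u. arcsine_weight R u * log_potential n a u) has_integral pi * (\<Sum>i<n. exp (a i))) {..<ln R}"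
proof -
  have "((\<lambda>u. \<Sum>i<n. arcsine_weight R u * log_coth (u - a i)) has_integral (\<Sum>i<n. pi * exp (a i))) {..<ln R}"
  proof (rule has_integral_sum)
    fix i assume "i \<in> {..<n}"
    then have "a i < ln R" using zero_neg[of i] ln_ge_zero[OF assms] by simp
    then show "((\<lambda>u. arcsine_weight R u * log_coth (u - a i)) has_integral pi * exp (a i)) {..<ln R}"
      using assms by (intro arcsine_weight_log_coth_has_integral) auto
  qed simp
  then show ?thesis by (simp add: log_potential_def sum_distrib_left)
qed

text \<open>For exp u between d and 1, off the zeros, the potential is at least L + ln d, and the
  weight with R = 1 has mass sqrt(1 - d^2) on that range.\<close>

lemma zero_sum_lower:
  assumes "0 < d" "d < 1"
  shows "sqrt (1 - d\<^sup>2) * (L + ln d) \<le> pi * (\<Sum>i<n. exp (a i))"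
\<comment> \<open>If L + ln d is negative, so is the claimed bound. Otherwise ln d >= -L, and the
  interval from ln d to 0 lies where \<open>potential_ge\<close> applies.\<close>
proof (cases "0 \<le> L + ln d")
  case False
  then have "sqrt (1 - d\<^sup>2) * (L + ln d) \<le> 0"
    using assms by (intro mult_nonneg_nonpos) (auto simp: power_le_one)
  also have "0 \<le> pi * (\<Sum>i<n. exp (a i))" by (intro mult_nonneg_nonneg sum_nonneg) auto
  finally show ?thesis .
next
  case True
  let ?f = "\<lambda>u. if u \<in> {ln d<..<0} then (L + ln d) * arcsine_weight 1 u else 0"
  have "(L + ln d) * sqrt (1\<^sup>2 - d\<^sup>2) \<le> pi * (\<Sum>i<n. exp (a i))"
  proof (rule has_integral_le)
    have "exp ` {ln d<..<0} = {d<..<1}"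
    proof -
      have "y \<in> exp ` {ln d<..<0}" if "d < y" "y < 1" for y
        using that assms by (intro image_eqI[of _ _ "ln y"]) auto
      then show ?thesis using assms exp_less_cancel_iff[of "ln d"] by auto
    qed
    then have "(?f has_integral (L + ln d) * sqrt (1\<^sup>2 - d\<^sup>2)) UNIV"
      using assms
      by - (rule has_integral_restrict_UNIV[THEN iffD2], rule has_integral_mult_right,
        rule arcsine_weight_has_integral, simp_all)
    then show "((\<lambda>u. if u \<in> a ` {..<n} then 0 else ?f u) has_integral (L + ln d) * sqrt (1\<^sup>2 - d\<^sup>2)) UNIV"
      by (rule has_integral_spike_finite[rotated 2, where S = "a ` {..<n}"]) auto
    show "((\<lambda>u. if u \<in> {..<ln 1} then arcsine_weight 1 u * log_potential n a u else 0)
        has_integral pi * (\<Sum>i<n. exp (a i))) UNIV"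
      unfolding has_integral_restrict_UNIV by (rule arcsine_weight_potential_has_integral) simp
    fix u
    have pot: "0 \<le> log_potential n a u"
      by (auto simp: log_potential_def log_coth_nonneg intro!: sum_nonneg)
    show "(if u \<in> a ` {..<n} then 0 else ?f u)
        \<le> (if u \<in> {..<ln 1} then arcsine_weight 1 u * log_potential n a u else 0)"
    proof (cases "u < 0")
      case u: True
      then have w: "0 \<le> arcsine_weight 1 u" using arcsine_weight_nonneg[of u 1] by simp
      have "(L + ln d) * arcsine_weight 1 u \<le> arcsine_weight 1 u * log_potential n a u"
        if "ln d < u" "u \<notin> a ` {..<n}"
      proof -
        have "L + ln d \<le> log_potential n a u"
          using potential_ge[of u] that u True by auto
        from mult_left_mono[OF this w] show ?thesis by (simp add: mult.commute)
      qed
      moreover have "0 \<le> arcsine_weight 1 u * log_potential n a u" using w pot by simp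
      ultimately show ?thesis using u by (simp split: if_split del: mult_cancel_right mult_le_cancel_left_pos)
    qed auto
  qed
  then show ?thesis by (simp add: mult.commute)
qed

text \<open>At R = 1 the weight is not square-integrable at its endpoint, hence R > 1. The product
  of weight and spikes is then split by an arithmetic-geometric inequality with parameter h: the
  bumps cost 16 h L and the squared weight 1/(4 h (R^2 - 1)). The kernel of the lowest zero costs at
  most pi.\<close>

lemma zero_sum_upper:
  assumes "1 < R" "0 < h"
  shows "pi * (\<Sum>i<n. exp (a i)) \<le> R * (L + ln 3) + pi + 16 * h * L + 1 / (4 * h * (R\<^sup>2 - 1))"
proof -
  let ?W = "arcsine_weight R"
  let ?C = "1 / (h * (R\<^sup>2 - 1))"
  let ?M = "\<lambda>u. (L + ln 3) * (if u \<in> {..<ln R} then ?W u else 0)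
    + (if u \<in> {..<ln R} then ?W u * log_coth (u - a 0) else 0)
    + 4 * h * bump_sum u + ?C * (if u \<in> {..0} then exp (4 * u) else 0)"
  have R: "0 < R\<^sup>2 - 1" "0 < ln R" using assms by (auto simp: one_less_power)
  then have C: "0 < ?C" using assms by simp
  have "pi * (\<Sum>i<n. exp (a i)) \<le> (L + ln 3) * sqrt (R\<^sup>2 - 0\<^sup>2) + pi * exp (a 0)
      + 4 * h * (4 * (y (n - 1) - y 0)) + ?C * (exp (4 * 0) / 4)"
  proof (rule has_integral_le)
    show "((\<lambda>u. if u \<in> {..<ln R} then ?W u * log_potential n a u else 0)
        has_integral pi * (\<Sum>i<n. exp (a i))) UNIV"
      unfolding has_integral_restrict_UNIV
      using assms by (intro arcsine_weight_potential_has_integral) simp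
    have "a 0 < ln R" using zero_neg[OF n_pos] R by linarith
    moreover have "exp ` {..<ln R} = {0<..<R}"
      using assms by (intro exp_image_lessThan_ln) simp
    ultimately show "(?M has_integral (L + ln 3) * sqrt (R\<^sup>2 - 0\<^sup>2) + pi * exp (a 0)
      + 4 * h * (4 * (y (n - 1) - y 0)) + ?C * (exp (4 * 0) / 4)) UNIV"
      using assms
      by (intro has_integral_add has_integral_mult_right bump_sum_has_integral
          has_integral_restrict_UNIV[THEN iffD2] exp_has_integral_atMost
          arcsine_weight_has_integral arcsine_weight_log_coth_has_integral) simp_all
    fix u
    have nonneg: "0 \<le> 4 * h * bump_sum u" "0 \<le> ?C * (if u \<in> {..0} then exp (4 * u) else 0)"
      using assms C by (auto simp: bump_sum_nonneg)
    have "?W u * log_potential n a u \<le> ?M u" if u: "u < ln R"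
    proof -
      have w: "0 \<le> ?W u" using arcsine_weight_nonneg[OF u] assms by simp
      have g: "0 \<le> ?W u * log_coth (u - a 0)" using w by (simp add: log_coth_nonneg)
      have L3: "0 \<le> L + ln 3" using L_nonneg by simp
      consider "u \<le> y 0" | "y (n - 1) \<le> u" | "y 0 \<le> u" "u \<le> y (n - 1)" by linarith
      then have "?W u * log_potential n a u \<le> (L + ln 3) * ?W u + ?W u * log_coth (u - a 0)
        + 4 * h * bump_sum u + ?C * (if u \<in> {..0} then exp (4 * u) else 0)"
      proof cases
        case 1
        have "exp (u - y 0) * (L + ln 3) \<le> 1 * (L + ln 3)"
          using 1 L3 by (intro mult_right_mono) auto
        then have "log_potential n a u \<le> (L + ln 3) + log_coth (u - a 0)"
          using potential_le_left[OF 1] by simp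
        from mult_left_mono[OF this w] show ?thesis using nonneg by (simp add: algebra_simps)
      next
        case 2
        have "exp (y (n - 1) - u) * (L + ln 3) \<le> 1 * (L + ln 3)"
          using 2 L3 by (intro mult_right_mono) auto
        then have "log_potential n a u \<le> L + ln 3"
          using potential_le_right[OF 2] by simp
        from mult_left_mono[OF this w] show ?thesis using nonneg g by (simp add: algebra_simps)
      next
        case 3
        then have "u \<le> 0" using node_le by simp
        let ?s = "sqrt (bump_sum u)"
        have s: "?s\<^sup>2 = bump_sum u" using bump_sum_nonneg by simp
        have "log_potential n a u \<le> (L + ln 3) + 4 * ?s"
          using potential_le_inside[OF 3] \<open>u \<le> 0\<close> by simp
        from mult_left_mono[OF this w]
        have 1: "?W u * log_potential n a u \<le> (L + ln 3) * ?W u + 4 * (?W u * ?s)"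
          by (simp add: algebra_simps)
        \<comment> \<open>Expanding this square gives 4 W s <= 4 h s^2 + W^2/h.\<close>
        have "0 \<le> (2 * h * ?s - ?W u)\<^sup>2 / h" using assms by simp
        also have "(2 * h * ?s - ?W u)\<^sup>2 = h * (4 * h * ?s\<^sup>2 - 4 * (?W u * ?s)) + (?W u)\<^sup>2"
          by algebra
        also have "\<dots> / h = 4 * h * ?s\<^sup>2 - 4 * (?W u * ?s) + (?W u)\<^sup>2 / h"
          using assms by (simp add: add_divide_distrib)
        finally have 2: "4 * (?W u * ?s) \<le> 4 * h * bump_sum u + (?W u)\<^sup>2 / h"
          unfolding s by linarith
        have "exp (2 * u) \<le> 1" using \<open>u \<le> 0\<close> by simp
        then have R1: "R\<^sup>2 - 1 \<le> R\<^sup>2 - exp (2 * u)" by simp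
        have "(?W u)\<^sup>2 = (exp (2 * u))\<^sup>2 / (R\<^sup>2 - exp (2 * u))"
        proof -
          have "0 \<le> R\<^sup>2 - exp (2 * u)" using R R1 by linarith
          then show ?thesis unfolding arcsine_weight_def power_divide by (simp only: real_sqrt_pow2)
        qed
        also have "\<dots> \<le> (exp (2 * u))\<^sup>2 / (R\<^sup>2 - 1)"
          using R(1) R1 by (intro divide_left_mono mult_pos_pos) (linarith | simp)+
        also have "(exp (2 * u))\<^sup>2 = exp (4 * u)" by (simp flip: exp_double)
        finally have "(?W u)\<^sup>2 / h \<le> exp (4 * u) / (R\<^sup>2 - 1) / h"
          using assms by (intro divide_right_mono) auto
        also have "\<dots> = ?C * exp (4 * u)" by (simp add: mult.commute)
        finally have "(?W u)\<^sup>2 / h \<le> ?C * exp (4 * u)" .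
        then show ?thesis using 1 2 g \<open>u \<le> 0\<close> by simp
      qed
      then show ?thesis using u by simp
    qed
    then show "(if u \<in> {..<ln R} then ?W u * log_potential n a u else 0) \<le> ?M u"
      using nonneg by auto
  qed
  also have "\<dots> \<le> R * (L + ln 3) + pi + 16 * h * L + 1 / (4 * h * (R\<^sup>2 - 1))"
  proof -
    have "exp (a 0) \<le> 1" using zero_neg[OF n_pos] by simp
    then have 1: "pi * exp (a 0) \<le> pi" by simp
    have "h * (y (n - 1) - y 0) \<le> h * L"
      using node_ge node_le assms by (intro mult_left_mono) auto
    then have 2: "4 * h * (4 * (y (n - 1) - y 0)) \<le> 16 * h * L" by argo
    have 3: "(L + ln 3) * sqrt (R\<^sup>2 - 0\<^sup>2) = R * (L + ln 3)" using assms by simp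
    have 4: "?C * (exp (4 * 0) / 4) = 1 / (4 * h * (R\<^sup>2 - 1))" by simp
    show ?thesis unfolding 3 4 using 1 2 by (intro add_mono order_refl)
  qed
  finally show ?thesis .
qed

end

section \<open>Equioscillation\<close>

lemma coprime_combination_aux:
  fixes p q w :: "real poly"
  assumes "coprime p q" "q \<noteq> 0" "degree p \<le> degree q" "degree q \<le> N" "degree w \<le> N + degree q"
  shows "\<exists>a b. w = a * q + b * p \<and> degree a \<le> N \<and> degree b \<le> N"
proof -
  obtain u v where uv: "u * q + v * p = 1"
    using bezout_coefficients_fst_snd[of q p] assms(1)
    by (metis coprime_commute coprime_iff_gcd_eq_1)
  \<comment> \<open>Reducing the cofactor of p modulo q makes it zero or of smaller degree than q;
    the degree of a is then forced by a q = w - b p.\<close>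
  define b where "b = (w * v) mod q"
  define a where "a = w * u + ((w * v) div q) * p"
  have "w = w * (u * q + v * p)" by (simp add: uv)
  also have "\<dots> = w * u * q + (w * v) * p" by (simp add: algebra_simps)
  also have "w * v = (w * v) div q * q + b" by (simp add: b_def)
  finally have eq: "w = a * q + b * p" by (simp add: a_def algebra_simps)
  have b: "b = 0 \<or> degree b < degree q"
    using degree_mod_less[OF assms(2)] by (simp add: b_def)
  have "degree a \<le> N"
  proof (cases "a = 0")
    case False
    have "degree (b * p) \<le> N + degree q"
      using degree_mult_le[of b p] b assms by auto
    moreover have "a * q = w - b * p" using eq by (simp add: algebra_simps)
    ultimately have "degree (a * q) \<le> N + degree q"
      using degree_diff_le[of w "N + degree q" "b * p"] assms by simp
    then show ?thesis using False assms by (simp add: degree_mult_eq)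
  qed simp
  then show ?thesis using eq b assms by (intro exI[of _ a] exI[of _ b]) auto
qed

text \<open>These combinations are the directions of variation: replacing p/q by (p + \<epsilon>
  a)/(q + \<epsilon> b) changes it by \<epsilon> (a q - b p)/(q (q + \<epsilon> b)). Cofactors are
  reduced modulo whichever of p and q has the larger degree.\<close>

lemma coprime_combination:
  fixes p q w :: "real poly"
  assumes "coprime p q" "q \<noteq> 0" "degree p \<le> N" "degree q \<le> N"
    and "degree w \<le> N + max (degree p) (degree q)"
  shows "\<exists>a b. w = a * q - b * p \<and> degree a \<le> N \<and> degree b \<le> N"
proof (cases "degree p \<le> degree q")
  case True
  then obtain a b where "w = a * q + b * p" "degree a \<le> N" "degree b \<le> N"
    using coprime_combination_aux[of p q N w] assms by (auto simp: max_def)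
  then show ?thesis by (intro exI[of _ a] exI[of _ "- b"]) auto
next
  case False
  then have "p \<noteq> 0" by auto
  with False obtain a b where "w = a * p + b * q" "degree a \<le> N" "degree b \<le> N"
    using coprime_combination_aux[of q p N w] assms by (auto simp: max_def coprime_commute)
  then show ?thesis by (intro exI[of _ b] exI[of _ "- a"]) auto
qed

section \<open>Alternation versus separation\<close>

definition alternating_chain :: "real set \<Rightarrow> real set \<Rightarrow> nat \<Rightarrow> (nat \<Rightarrow> real) \<Rightarrow> bool" where
  "alternating_chain A B m z \<longleftrightarrow> (\<forall>i<m. z i < z (Suc i)) \<and>
     ((\<forall>i\<le>m. z i \<in> (if even i then A else B)) \<or> (\<forall>i\<le>m. z i \<in> (if even i then B else A)))"

lemma alternating_chain_commute: "alternating_chain A B m z = alternating_chain B A m z"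
  unfolding alternating_chain_def by blast

text \<open>The last clause makes the induction work: \<open>w\<close> keeps its sign to the right of the largest point.\<close>

definition separating_poly :: "real set \<Rightarrow> real set \<Rightarrow> real poly \<Rightarrow> bool" where
  "separating_poly A B w \<longleftrightarrow> (\<forall>x\<in>A. 0 < poly w x) \<and> (\<forall>x\<in>B. poly w x < 0) \<and>
     (\<forall>c\<in>A \<union> B. (\<forall>c'\<in>A \<union> B. c' \<le> c) \<longrightarrow> (\<forall>x\<ge>c. 0 < poly w x * poly w c))"

lemma separating_poly_uminus: "separating_poly A B w \<Longrightarrow> separating_poly B A (- w)"
  unfolding separating_poly_def by (auto simp: Un_commute)

text \<open>The hypothesis is applied to A cut off at \<beta>, the top of B. A chain for the cut set
  is extended by one point; a separating polynomial gains a linear factor whose root lies between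
  \<beta> and the next point \<gamma> of A.\<close>

lemma alternation_or_separation_step:
  fixes A B :: "real set"
  assumes AB: "compact A" "compact B" "A \<inter> B = {}"
    and top: "\<alpha> \<in> A" "\<forall>x\<in>A. x \<le> \<alpha>" "\<beta> \<in> B" "\<forall>x\<in>B. x \<le> \<beta>" "\<beta> < \<alpha>"
    and IH: "(\<exists>z. alternating_chain (A \<inter> {..\<beta>}) B (Suc m) z) \<or>
      (\<exists>w. degree w \<le> m \<and> separating_poly (A \<inter> {..\<beta>}) B w)"
  shows "(\<exists>z. alternating_chain A B (Suc (Suc m)) z) \<or> (\<exists>w. degree w \<le> Suc m \<and> separating_poly A B w)"
  using IH
proof (elim disjE exE conjE)
  fix z assume z: "alternating_chain (A \<inter> {..\<beta>}) B (Suc m) z"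
  have mono: "z i < z (Suc i)" if "i < Suc m" for i
    using z that by (auto simp: alternating_chain_def)
  let ?z' = "\<lambda>c. z(Suc (Suc m) := c)"
  have mono': "?z' c i < ?z' c (Suc i)" if "i < Suc (Suc m)" "z (Suc m) < c" for i c
    using that mono[of i] by (cases "i = Suc m") auto
  have mem: "z (Suc m) \<in> B \<Longrightarrow> z (Suc m) < \<alpha>" "z (Suc m) \<in> A \<inter> {..\<beta>} \<Longrightarrow> z (Suc m) < \<beta>"
    using top AB(3) by (force, metis IntE atMost_iff disjoint_iff order_le_less)
  \<comment> \<open>A chain ending in B is continued by \<alpha>; one ending in A below \<beta> is
    continued by \<beta>. The parity of m tells which case occurs.\<close>
  have "\<exists>c. alternating_chain A B (Suc (Suc m)) (?z' c)"
  proof -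
    consider (1) "\<forall>i\<le>Suc m. z i \<in> (if even i then A \<inter> {..\<beta>} else B)"
      | (2) "\<forall>i\<le>Suc m. z i \<in> (if even i then B else A \<inter> {..\<beta>})"
      using z by (auto simp: alternating_chain_def)
    then show ?thesis
    proof cases
      case 1
      let ?c = "if even m then \<alpha> else \<beta>"
      have "z (Suc m) < ?c"
        using 1[rule_format, of "Suc m"] mem by (cases "even m") auto
      moreover have "?z' ?c i \<in> (if even i then A else B)" if "i \<le> Suc (Suc m)" for i
        using 1[rule_format, of i] that top by (cases "i = Suc (Suc m)") (auto split: if_splits)
      ultimately show ?thesis
        unfolding alternating_chain_def using mono' by (intro exI[of _ ?c]) blast
    next
      case 2
      let ?c = "if even m then \<beta> else \<alpha>"
      have "z (Suc m) < ?c"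
        using 2[rule_format, of "Suc m"] mem by (cases "even m") auto
      moreover have "?z' ?c i \<in> (if even i then B else A)" if "i \<le> Suc (Suc m)" for i
        using 2[rule_format, of i] that top by (cases "i = Suc (Suc m)") (auto split: if_splits)
      ultimately show ?thesis
        unfolding alternating_chain_def using mono' by (intro exI[of _ ?c]) blast
    qed
  qed
  then show ?thesis by blast
next
  fix w assume w: "degree w \<le> m" "separating_poly (A \<inter> {..\<beta>}) B w"
  have "compact (A \<inter> {\<beta>..})" using AB by (intro compact_Int_closed) auto
  moreover have "A \<inter> {\<beta>..} \<noteq> {}" using top by force
  ultimately obtain \<gamma> where \<gamma>: "\<gamma> \<in> A" "\<beta> \<le> \<gamma>" "\<forall>x\<in>A \<inter> {\<beta>..}. \<gamma> \<le> x"
    using compact_attains_inf[of "A \<inter> {\<beta>..}"] by auto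
  then have "\<beta> < \<gamma>" using top AB(3) by (metis disjoint_iff order_le_less)
  define r where "r = (\<beta> + \<gamma>) / 2"
  have r: "\<beta> < r" "r < \<gamma>" using \<open>\<beta> < \<gamma>\<close> by (auto simp: r_def field_simps)
  have wpos: "\<And>x. x \<in> A \<Longrightarrow> x \<le> \<beta> \<Longrightarrow> 0 < poly w x" and wneg: "\<And>x. x \<in> B \<Longrightarrow> poly w x < 0"
    using w by (auto simp: separating_poly_def)
  \<comment> \<open>\<beta> is the largest point of the cut union, so w stays negative to its right;
    the factor r - x then restores the positive sign on the rest of A.\<close>
  have wright: "poly w x < 0" if "\<beta> \<le> x" for x
  proof -
    have "0 < poly w x * poly w \<beta>"
      using w(2) top that unfolding separating_poly_def by auto
    then show ?thesis using wneg[OF top(3)] by (simp add: zero_less_mult_iff)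
  qed
  let ?v = "w * [:r, - 1:]"
  have v: "poly ?v x = poly w x * (r - x)" for x by (simp add: algebra_simps)
  have vbig: "0 < poly ?v x" if "\<gamma> \<le> x" for x
    unfolding v using wright[of x] that r by (intro mult_neg_neg) auto
  have vA: "0 < poly ?v x" if "x \<in> A" for x
  proof (cases "x \<le> \<beta>")
    case True
    then show ?thesis unfolding v using wpos[OF that True] r by (intro mult_pos_pos) auto
  next
    case False
    then show ?thesis using \<gamma>(3) that by (intro vbig) auto
  qed
  have vB: "poly ?v x < 0" if "x \<in> B" for x
    unfolding v using wneg[OF that] top(4) that r by (intro mult_neg_pos) force+
  have "0 < poly ?v x * poly ?v c" if "\<forall>c'\<in>A \<union> B. c' \<le> c" "c \<le> x" for c x
    using that \<gamma>(1) by (intro mult_pos_pos vbig) force+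
  then have "separating_poly A B ?v"
    unfolding separating_poly_def using vA vB by blast
  moreover have "degree ?v \<le> Suc m"
    using degree_mult_le[of w "[:r, - 1:]"] w(1) by simp
  ultimately show ?thesis by blast
qed

lemma separating_poly_empty:
  assumes "A = {} \<or> B = {}"
  shows "\<exists>w. degree w \<le> m \<and> separating_poly A B w"
proof (cases "A = {}")
  case True
  then show ?thesis by (intro exI[of _ "- 1"]) (auto simp: separating_poly_def)
next
  case False
  then show ?thesis using assms by (intro exI[of _ 1]) (auto simp: separating_poly_def)
qed

text \<open>Induction on m, cutting the set that reaches higher at the maximum of the other. A chain
  with index \<open>Suc m\<close> has m + 2 points, hence m + 1 sign changes, one more than a
  polynomial of degree m can follow.\<close>

lemma alternation_or_separation:
  fixes A B :: "real set"
  assumes "compact A" "compact B" "A \<inter> B = {}"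
  shows "(\<exists>z. alternating_chain A B (Suc m) z) \<or> (\<exists>w. degree w \<le> m \<and> separating_poly A B w)"
  using assms
proof (induction m arbitrary: A B)
  case 0
  show ?case
  proof (cases "A = {} \<or> B = {}")
    case False
    then obtain x y where xy: "x \<in> A" "y \<in> B" by blast
    then have "x \<noteq> y" using 0 by blast
    have "alternating_chain A B (Suc 0) (\<lambda>i. if even i = (x < y) then x else y)"
      using xy \<open>x \<noteq> y\<close> by (cases "x < y") (auto simp: alternating_chain_def le_Suc_eq)
    then show ?thesis by blast
  qed (use separating_poly_empty in blast)
next
  case (Suc m)
  show ?case
  proof (cases "A = {} \<or> B = {}")
    case True
    then show ?thesis using separating_poly_empty by blast
  next
    case False
    then obtain \<alpha> \<beta> where top: "\<alpha> \<in> A" "\<forall>x\<in>A. x \<le> \<alpha>" "\<beta> \<in> B" "\<forall>x\<in>B. x \<le> \<beta>"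
      using compact_attains_sup[of A] compact_attains_sup[of B] Suc.prems by metis
    then have "\<alpha> \<noteq> \<beta>" using Suc.prems by blast
    then consider "\<beta> < \<alpha>" | "\<alpha> < \<beta>" by linarith
    then show ?thesis
    proof cases
      case 1
      show ?thesis
        by (rule alternation_or_separation_step[OF Suc.prems top 1], rule Suc.IH)
           (use Suc.prems in \<open>auto intro: compact_Int_closed\<close>)
    next
      case 2
      \<comment> \<open>The opposite order reduces to the first one by exchanging A and B, which
        negates the separating polynomial.\<close>
      have "(\<exists>z. alternating_chain B A (Suc (Suc m)) z) \<or> (\<exists>w. degree w \<le> Suc m \<and> separating_poly B A w)"
        by (rule alternation_or_separation_step[OF Suc.prems(2,1) _ top(3,4,1,2) 2], use Suc.prems in blast,
            rule Suc.IH) (use Suc.prems in \<open>auto intro: compact_Int_closed\<close>)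
      then show ?thesis
        using alternating_chain_commute separating_poly_uminus by (metis degree_minus)
    qed
  qed
qed

section \<open>Optimality condition for the best approximant\<close>

definition sqrt_residual :: "real poly \<Rightarrow> real poly \<Rightarrow> real \<Rightarrow> real" where
  "sqrt_residual p q x = sqrt x - poly p x / poly q x"

lemma sqrt_residual_continuous:
  assumes "rat_cand N p q"
  shows "continuous_on {0..1} (sqrt_residual p q)"
  using assms unfolding rat_cand_def sqrt_residual_def[abs_def] by (intro continuous_intros) auto

lemma sqrt_err_attained:
  assumes "rat_cand N p q"
  shows "\<exists>x\<in>{0..1}. sqrt_err p q = \<bar>sqrt_residual p q x\<bar> \<and>
    (\<forall>y\<in>{0..1}. \<bar>sqrt_residual p q y\<bar> \<le> sqrt_err p q)"
proof -
  have "continuous_on {0..1} (\<lambda>x. \<bar>sqrt_residual p q x\<bar>)"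
    by (intro continuous_intros sqrt_residual_continuous[OF assms])
  then obtain x where x: "x \<in> {0..1}" "\<forall>y\<in>{0..1}. \<bar>sqrt_residual p q y\<bar> \<le> \<bar>sqrt_residual p q x\<bar>"
    using continuous_attains_sup[of "{0..1::real}" "\<lambda>x. \<bar>sqrt_residual p q x\<bar>"] by auto
  then have "sqrt_err p q = \<bar>sqrt_residual p q x\<bar>"
    unfolding sqrt_err_def sqrt_residual_def by (intro cSup_eq_maximum) auto
  then show ?thesis using x by auto
qed

lemma sqrt_residual_le:
  "rat_cand N p q \<Longrightarrow> x \<in> {0..1} \<Longrightarrow> \<bar>sqrt_residual p q x\<bar> \<le> sqrt_err p q"
  using sqrt_err_attained by blast

text \<open>Kolmogorov's criterion: if a q - b p had the sign of the error at every extremal point,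
  perturbing along (a, b) with steps tending to 0 would lower the error. Points where the perturbed
  errors are maximal accumulate at an extremal point, and near it the error has been strictly
  reduced.\<close>

lemma best_no_descent:
  assumes best: "best_sqrt_approx N p q" and deg: "degree a \<le> N" "degree b \<le> N"
    and sep: "\<And>x. x \<in> {0..1} \<Longrightarrow> \<bar>sqrt_residual p q x\<bar> = sqrt_err p q \<Longrightarrow>
      0 < sqrt_residual p q x * poly (a * q - b * p) x"
  shows False
proof -
  define e where "e = sqrt_residual p q"
  define w where "w = a * q - b * p"
  define E where "E = sqrt_err p q"
  have cand: "rat_cand N p q" using best by (simp add: best_sqrt_approx_def)
  then have qnz: "\<And>x. x \<in> {0..1} \<Longrightarrow> poly q x \<noteq> 0" by (auto simp: rat_cand_def)
  have "continuous_on {0..1} (\<lambda>x. \<bar>poly q x\<bar>)" by (intro continuous_intros)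
  then obtain x0 where x0: "x0 \<in> {0..1}" "\<forall>x\<in>{0..1}. \<bar>poly q x0\<bar> \<le> \<bar>poly q x\<bar>"
    using continuous_attains_inf[of "{0..1::real}" "\<lambda>x. \<bar>poly q x\<bar>"] by auto
  define c where "c = \<bar>poly q x0\<bar>"
  have c: "0 < c" "\<And>x. x \<in> {0..1} \<Longrightarrow> c \<le> \<bar>poly q x\<bar>" using x0 qnz by (auto simp: c_def)
  have bound: "\<exists>K>0. \<forall>x\<in>{0..1}. \<bar>poly f x\<bar> \<le> K" for f :: "real poly"
  proof -
    have "compact (poly f ` {0..1})" by (intro compact_continuous_image continuous_intros compact_Icc)
    then have "bounded (poly f ` {0..1})" by (rule compact_imp_bounded)
    then show ?thesis unfolding bounded_pos by auto
  qed
  obtain K where K: "0 < K" "\<And>x. x \<in> {0..1} \<Longrightarrow> \<bar>poly b x\<bar> \<le> K" using bound[of b] by auto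
  obtain W where W: "0 < W" "\<And>x. x \<in> {0..1} \<Longrightarrow> \<bar>poly w x\<bar> \<le> W" using bound[of w] by auto
  \<comment> \<open>This step size keeps |\<epsilon> b| <= c/2 <= |q|/2, so the perturbed
    denominator keeps the sign of q.\<close>
  define \<epsilon> where "\<epsilon> n = c / (2 * K * real (Suc n))" for n
  have \<epsilon>: "0 < \<epsilon> n" "\<epsilon> n * K \<le> c / 2" for n
  proof -
    show "0 < \<epsilon> n" using c(1) K(1) by (simp add: \<epsilon>_def)
    have "\<epsilon> n * K = (c / 2) / real (Suc n)" using K(1) by (simp add: \<epsilon>_def del: of_nat_Suc)
    also have "\<dots> \<le> (c / 2) / 1" using c(1) by (intro divide_left_mono) auto
    finally show "\<epsilon> n * K \<le> c / 2" by simp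
  qed
  have \<epsilon>0: "\<epsilon> \<longlonglongrightarrow> 0"
  proof -
    have "(\<lambda>n. c / (2 * K) * inverse (real (Suc n))) \<longlonglongrightarrow> c / (2 * K) * 0"
      by (intro tendsto_mult tendsto_const LIMSEQ_inverse_real_of_nat)
    moreover have "\<epsilon> = (\<lambda>n. c / (2 * K) * inverse (real (Suc n)))"
      by (intro ext) (simp only: \<epsilon>_def divide_inverse inverse_mult_distrib mult.assoc)
    ultimately show ?thesis by simp
  qed
  define qn where "qn n = q + smult (\<epsilon> n) b" for n
  define pn where "pn n = p + smult (\<epsilon> n) a" for n
  have qn: "c\<^sup>2 / 2 \<le> poly q x * poly (qn n) x" if "x \<in> {0..1}" for x n
  proof -
    have "\<bar>\<epsilon> n * poly b x\<bar> \<le> \<epsilon> n * K"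
      using \<epsilon>(1)[of n] K(2)[OF that] by (simp add: abs_mult)
    then have "\<bar>\<epsilon> n * poly b x\<bar> \<le> \<bar>poly q x\<bar> / 2" using \<epsilon>(2)[of n] c(2)[OF that] by linarith
    then have "\<bar>poly q x\<bar> * \<bar>\<epsilon> n * poly b x\<bar> \<le> \<bar>poly q x\<bar> * (\<bar>poly q x\<bar> / 2)"
      by (intro mult_left_mono) auto
    then have "\<bar>poly q x * (\<epsilon> n * poly b x)\<bar> \<le> (poly q x)\<^sup>2 / 2"
      by (simp add: abs_mult power2_eq_square)
    moreover have "c\<^sup>2 \<le> (poly q x)\<^sup>2"
      using power_mono[OF c(2)[OF that], of 2] c(1) by simp
    moreover have "poly q x * poly (qn n) x = (poly q x)\<^sup>2 + poly q x * (\<epsilon> n * poly b x)"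
      by (simp add: qn_def power2_eq_square algebra_simps)
    ultimately show ?thesis by linarith
  qed
  have qqpos: "0 < poly q x * poly (qn n) x" if "x \<in> {0..1}" for x n
    using qn[OF that, of n] c(1) by (smt (verit) half_gt_zero zero_less_power)
  \<comment> \<open>The exact change of the rational function: the perturbed error is e -
    \<delta>.\<close>
  define \<delta> where "\<delta> n x = \<epsilon> n * poly w x / (poly q x * poly (qn n) x)" for n x
  have cand_n: "rat_cand N (pn n) (qn n)" for n
    unfolding rat_cand_def
  proof (intro conjI ballI)
    show "degree (pn n) \<le> N" "degree (qn n) \<le> N"
      using cand deg by (auto simp: rat_cand_def pn_def qn_def intro!: degree_add_le order_trans[OF degree_smult_le])
    show "poly (qn n) x \<noteq> 0" if "x \<in> {0..1}" for x using qqpos[OF that, of n] by auto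
  qed
  have res_n: "sqrt_residual (pn n) (qn n) x = e x - \<delta> n x" if "x \<in> {0..1}" for n x
  proof -
    have nz: "poly q x \<noteq> 0" "poly (qn n) x \<noteq> 0" using qqpos[OF that, of n] by auto
    have "poly (pn n) x / poly (qn n) x - poly p x / poly q x
        = (poly (pn n) x * poly q x - poly p x * poly (qn n) x) / (poly q x * poly (qn n) x)"
      using nz by (simp add: field_simps)
    also have "poly (pn n) x * poly q x - poly p x * poly (qn n) x = \<epsilon> n * poly w x"
      by (simp add: pn_def qn_def w_def algebra_simps)
    finally show ?thesis by (simp add: sqrt_residual_def e_def \<delta>_def)
  qed
  have \<delta>_le: "\<bar>\<delta> n x\<bar> \<le> \<epsilon> n * W / (c\<^sup>2 / 2)" if "x \<in> {0..1}" for n x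
  proof -
    have "\<bar>\<delta> n x\<bar> = \<epsilon> n * \<bar>poly w x\<bar> / (poly q x * poly (qn n) x)"
      using \<epsilon>(1)[of n] qqpos[OF that, of n] unfolding \<delta>_def abs_divide abs_mult[of "\<epsilon> n"] by simp
    also have "\<dots> \<le> \<epsilon> n * W / (c\<^sup>2 / 2)"
      using \<epsilon>(1)[of n] W(1) W(2)[OF that] qn[OF that, of n] c(1)
      by (intro frac_le mult_left_mono mult_nonneg_nonneg) auto
    finally show ?thesis .
  qed
  \<comment> \<open>By optimality every perturbed error still reaches E somewhere; these points are
    followed to an accumulation point \<open>l\<close>.\<close>
  have "\<exists>x. x \<in> {0..1} \<and> E \<le> \<bar>e x - \<delta> n x\<bar>" for n
  proof -
    obtain x where "x \<in> {0..1}" "sqrt_err (pn n) (qn n) = \<bar>sqrt_residual (pn n) (qn n) x\<bar>"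
      using sqrt_err_attained[OF cand_n] by blast
    moreover have "E \<le> sqrt_err (pn n) (qn n)"
      using best cand_n by (auto simp: best_sqrt_approx_def E_def)
    ultimately show ?thesis using res_n by auto
  qed
  then obtain X where X: "\<And>n. X n \<in> {0..1}" "\<And>n. E \<le> \<bar>e (X n) - \<delta> n (X n)\<bar>" by metis
  obtain l r where l: "l \<in> {0..1}" "strict_mono r" "(X \<circ> r) \<longlonglongrightarrow> l"
    using compact_Icc[of 0 "1::real"] X(1) unfolding compact_def by metis
  have e_cont: "continuous_on {0..1} e" unfolding e_def by (rule sqrt_residual_continuous[OF cand])
  have e_lim: "(\<lambda>n. e (X (r n))) \<longlonglongrightarrow> e l"
    using continuous_on_tendsto_compose[OF e_cont l(3) l(1)] X(1) by (simp add: o_def)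
  have w_lim: "(\<lambda>n. poly w (X (r n))) \<longlonglongrightarrow> poly w l"
    using l(3) by (intro tendsto_poly) (simp add: o_def)
  have "(\<lambda>n. \<epsilon> (r n) * W / (c\<^sup>2 / 2)) \<longlonglongrightarrow> 0 * W / (c\<^sup>2 / 2)"
    using LIMSEQ_subseq_LIMSEQ[OF \<epsilon>0 l(2)] c(1) by (intro tendsto_intros) (auto simp: o_def)
  then have \<epsilon>_lim: "(\<lambda>n. \<epsilon> (r n) * W / (c\<^sup>2 / 2)) \<longlonglongrightarrow> 0" by simp
  have \<delta>_lim: "(\<lambda>n. \<delta> (r n) (X (r n))) \<longlonglongrightarrow> 0"
    by (rule Lim_null_comparison[OF _ \<epsilon>_lim]) (use \<delta>_le X(1) in \<open>simp add: always_eventually\<close>)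
  have "(\<lambda>n. \<bar>e (X (r n)) - \<delta> (r n) (X (r n))\<bar>) \<longlonglongrightarrow> \<bar>e l - 0\<bar>"
    by (intro tendsto_intros e_lim \<delta>_lim)
  then have "E \<le> \<bar>e l - 0\<bar>" using X(2) by (intro LIMSEQ_le_const) auto
  then have el: "\<bar>e l\<bar> = E" using sqrt_residual_le[OF cand l(1)] by (simp add: e_def E_def)
  have pos: "0 < e l * poly w l" using sep[OF l(1)] el by (simp add: e_def E_def w_def)
  then have "0 < \<bar>e l\<bar>" by auto
  have "eventually (\<lambda>n. 0 < e (X (r n)) * poly w (X (r n))) sequentially"
    using order_tendstoD(1)[OF tendsto_mult[OF e_lim w_lim] pos] .
  moreover have "(\<lambda>n. \<bar>e (X (r n))\<bar> - \<bar>\<delta> (r n) (X (r n))\<bar>) \<longlonglongrightarrow> \<bar>e l\<bar> - \<bar>0\<bar>"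
    by (intro tendsto_intros e_lim \<delta>_lim)
  then have "eventually (\<lambda>n. 0 < \<bar>e (X (r n))\<bar> - \<bar>\<delta> (r n) (X (r n))\<bar>) sequentially"
    using \<open>0 < \<bar>e l\<bar>\<close> by (intro order_tendstoD(1)) auto
  \<comment> \<open>Near \<open>l\<close>, e and \<delta> have the same sign and |\<delta>| < |e|,
    so |e - \<delta>| < |e| <= E, against the choice of \<open>X\<close>.\<close>
  ultimately have "eventually (\<lambda>n. False) sequentially"
  proof eventually_elim
    case (elim n)
    let ?x = "X (r n)"
    have "0 < e ?x * \<delta> (r n) ?x"
    proof -
      have "e ?x * \<delta> (r n) ?x = \<epsilon> (r n) * (e ?x * poly w ?x) / (poly q ?x * poly (qn (r n)) ?x)"
        by (simp add: \<delta>_def)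
      also have "0 < \<dots>"
        by (rule divide_pos_pos[OF mult_pos_pos[OF \<epsilon>(1) elim(1)] qqpos[OF X(1)]])
      finally show ?thesis .
    qed
    then have "\<bar>e ?x - \<delta> (r n) ?x\<bar> < \<bar>e ?x\<bar>"
      using elim(2) by (cases "0 < e ?x") (auto simp: zero_less_mult_iff abs_if split: if_splits)
    also have "\<dots> \<le> E" using sqrt_residual_le[OF cand X(1)] by (simp add: e_def E_def)
    finally show False using X(2)[of "r n"] by simp
  qed
  then show False by simp
qed

section \<open>The numerator of the residual in the variable t = sqrt x\<close>

definition residual_numerator :: "real poly \<Rightarrow> real poly \<Rightarrow> real poly" where
  "residual_numerator p q = [:0, 1:] * pcompose q (monom 1 2) - pcompose p (monom 1 2)"

lemma poly_residual_numerator: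
  "poly (residual_numerator p q) t = t * poly q (t\<^sup>2) - poly p (t\<^sup>2)"
  by (simp add: residual_numerator_def poly_pcompose poly_monom)

lemma residual_numerator_eq:
  assumes "poly q (t\<^sup>2) \<noteq> 0" "0 \<le> t"
  shows "poly (residual_numerator p q) t = sqrt_residual p q (t\<^sup>2) * poly q (t\<^sup>2)"
  using assms by (simp add: poly_residual_numerator sqrt_residual_def field_simps)

lemma degree_residual_numerator_le:
  "degree (residual_numerator p q) \<le> 2 * max (degree p) (degree q) + 1"
proof -
  have "degree ([:0, 1:] * pcompose q (monom 1 2)) \<le> 1 + degree q * 2"
    by (intro order_trans[OF degree_mult_le]) (simp add: degree_pcompose degree_monom_eq)
  moreover have "degree (pcompose p (monom 1 2)) = degree p * 2"
    by (simp add: degree_pcompose degree_monom_eq)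
  ultimately show ?thesis
    unfolding residual_numerator_def by (intro degree_diff_le) auto
qed

lemma residual_numerator_nonzero:
  assumes "rat_cand N p q"
  shows "residual_numerator p q \<noteq> 0"
proof
  assume "residual_numerator p q = 0"
  \<comment> \<open>The values at 1 and -1 differ by 2 q(1), and q has no zero on [0, 1].\<close>
  then have "poly (residual_numerator p q) 1 = 0" "poly (residual_numerator p q) (-1) = 0" by simp_all
  then have "poly q 1 = 0" by (simp add: poly_residual_numerator)
  then show False using assms by (auto simp: rat_cand_def)
qed

lemma sqrt_err_pos:
  assumes "rat_cand N p q"
  shows "0 < sqrt_err p q"
proof (rule ccontr)
  assume neg: "\<not> 0 < sqrt_err p q"
  have "poly (residual_numerator p q) t = 0" if t: "t \<in> {0..1}" for t
  proof -
    have t2: "t\<^sup>2 \<in> {0..1}" using t by (auto simp: power_le_one)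
    then have "sqrt_residual p q (t\<^sup>2) = 0" using sqrt_residual_le[OF assms t2] neg by linarith
    moreover have "poly q (t\<^sup>2) \<noteq> 0" using assms t2 by (auto simp: rat_cand_def)
    ultimately show ?thesis using residual_numerator_eq[of q t p] t by simp
  qed
  then have "{0..1} \<subseteq> {t. poly (residual_numerator p q) t = 0}" by auto
  then have "finite {0..1::real}"
    using poly_roots_finite[OF residual_numerator_nonzero[OF assms]] finite_subset by blast
  then show False by (simp add: infinite_Icc)
qed

lemma poly_same_sign:
  fixes q :: "real poly"
  assumes "\<forall>x\<in>{0..1}. poly q x \<noteq> 0" "x \<in> {0..1}" "y \<in> {0..1}"
  shows "0 < poly q x * poly q y"
  using assms(2,3)
proof (induction x y rule: linorder_wlog)
  case (le x y)
  show ?case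
  proof (rule ccontr)
    assume "\<not> ?thesis"
    then have neg: "poly q x * poly q y < 0" using assms(1) le by (simp add: linorder_not_less less_le)
    then have "x \<noteq> y" by (auto simp: mult_less_0_iff)
    then obtain z where "x < z" "z < y" "poly q z = 0"
      using poly_IVT[of x y q] neg le by auto
    then show False using assms(1) le by auto
  qed
qed (simp add: mult.commute)

text \<open>A polynomial of degree at most m separating the points with error E from those with
  error -E would have the form a q - b p and give a descent direction. So the dichotomy yields m + 2
  alternating extremal points.\<close>

lemma best_sqrt_approx_alternation:
  assumes best: "best_sqrt_approx N p q"
  defines "m \<equiv> N + max (degree p) (degree q)"
  obtains z :: "nat \<Rightarrow> real" where
    "\<And>i. i \<le> m \<Longrightarrow> z i < z (Suc i)"
    "\<And>i. i \<le> Suc m \<Longrightarrow> z i \<in> {0..1} \<and> \<bar>sqrt_residual p q (z i)\<bar> = sqrt_err p q"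
    "\<And>i. i \<le> m \<Longrightarrow> sqrt_residual p q (z (Suc i)) = - sqrt_residual p q (z i)"
proof -
  define e where "e = sqrt_residual p q"
  define E where "E = sqrt_err p q"
  have cand: "rat_cand N p q" and cop: "coprime p q" using best by (auto simp: best_sqrt_approx_def)
  have "0 < E" unfolding E_def by (rule sqrt_err_pos[OF cand])
  have e_cont: "continuous_on {0..1} e" unfolding e_def by (rule sqrt_residual_continuous[OF cand])
  define A where "A = {x \<in> {0..1}. e x = E}"
  define B where "B = {x \<in> {0..1}. e x = - E}"
  have comp: "compact {x \<in> {0..1}. e x = v}" for v
  proof -
    have "closed ({0..1} \<inter> e -` {v})"
      by (rule continuous_closed_preimage[OF e_cont]) auto
    then have "compact ({0..1} \<inter> ({0..1} \<inter> e -` {v}))"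
      by (intro compact_Int_closed compact_Icc)
    moreover have "{0..1} \<inter> ({0..1} \<inter> e -` {v}) = {x \<in> {0..1}. e x = v}" by auto
    ultimately show ?thesis by simp
  qed
  have "\<not> (\<exists>w. degree w \<le> m \<and> separating_poly A B w)"
  proof
    assume "\<exists>w. degree w \<le> m \<and> separating_poly A B w"
    then obtain w where w: "degree w \<le> m" "separating_poly A B w" by blast
    have "q \<noteq> 0" using cand by (auto simp: rat_cand_def dest: bspec[of _ _ 0])
    then obtain a b where ab: "w = a * q - b * p" "degree a \<le> N" "degree b \<le> N"
      using coprime_combination[OF cop, of N w] w(1) cand by (auto simp: m_def rat_cand_def)
    show False
    proof (rule best_no_descent[OF best ab(2,3)])
      fix x :: real assume x: "x \<in> {0..1}" "\<bar>sqrt_residual p q x\<bar> = sqrt_err p q"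
      then have "e x = E \<or> e x = - E" by (auto simp: e_def E_def)
      then show "0 < sqrt_residual p q x * poly (a * q - b * p) x"
        unfolding ab(1)[symmetric] e_def[symmetric]
        using w(2) x(1) \<open>0 < E\<close>
        by (auto simp: separating_poly_def A_def B_def mult_less_0_iff)
    qed
  qed
  moreover have "compact A" "compact B" "A \<inter> B = {}"
    unfolding A_def B_def using comp \<open>0 < E\<close> by auto
  ultimately obtain z where z: "alternating_chain A B (Suc m) z"
    using alternation_or_separation[of A B m] by blast
  show ?thesis
  proof (rule that)
    show "z i < z (Suc i)" if "i \<le> m" for i using z that by (auto simp: alternating_chain_def)
    show "z i \<in> {0..1} \<and> \<bar>sqrt_residual p q (z i)\<bar> = sqrt_err p q" if "i \<le> Suc m" for i
    proof -
      have "z i \<in> A \<or> z i \<in> B" using z that by (auto simp: alternating_chain_def split: if_splits)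
      then show ?thesis using \<open>0 < E\<close> by (auto simp: A_def B_def e_def[symmetric] E_def[symmetric])
    qed
    show "sqrt_residual p q (z (Suc i)) = - sqrt_residual p q (z i)" if "i \<le> m" for i
    proof -
      have "z i \<in> A \<and> z (Suc i) \<in> B \<or> z i \<in> B \<and> z (Suc i) \<in> A"
      proof -
        consider "\<forall>i\<le>Suc m. z i \<in> (if even i then A else B)" | "\<forall>i\<le>Suc m. z i \<in> (if even i then B else A)"
          using z by (auto simp: alternating_chain_def)
        then show ?thesis
        proof cases
          case 1
          then show ?thesis using 1[rule_format, of i] 1[rule_format, of "Suc i"] that by (cases "even i") auto
        next
          case 2
          then show ?thesis using 2[rule_format, of i] 2[rule_format, of "Suc i"] that by (cases "even i") auto
        qed
      qed
      then show ?thesis by (auto simp: A_def B_def e_def[symmetric])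
    qed
  qed
qed

lemma poly_eq_prod_roots:
  fixes h :: "real poly"
  assumes "degree h \<le> n" "inj_on \<tau> {..<n}" "\<And>i. i < n \<Longrightarrow> poly h (\<tau> i) = 0"
  shows "h = smult (coeff h n) (\<Prod>i<n. [:- \<tau> i, 1:])"
proof -
  let ?P = "\<Prod>i<n. [:- \<tau> i, 1:]"
  let ?D = "h - smult (coeff h n) ?P"
  have deg: "degree ?P = n" by (subst degree_prod_eq_sum_degree) auto
  have "lead_coeff ?P = 1" by (simp add: lead_coeff_prod)
  then have c: "coeff ?P n = 1" using deg by simp
  have "?D = 0"
  proof (rule ccontr)
    assume nz: "?D \<noteq> 0"
    have "degree ?D \<le> n"
      using assms(1) deg by (intro degree_diff_le) (auto intro: order_trans[OF degree_smult_le])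
    moreover have "coeff ?D n = 0" using c by simp
    ultimately have "degree ?D < n" using nz by (metis leading_coeff_0_iff order_le_less)
    moreover have "\<tau> ` {..<n} \<subseteq> {x. poly ?D x = 0}"
      using assms(3) by (auto simp: poly_prod)
    then have "card (\<tau> ` {..<n}) \<le> card {x. poly ?D x = 0}"
      by (intro card_mono poly_roots_finite[OF nz])
    then have "n \<le> card {x. poly ?D x = 0}" using assms(2) by (simp add: card_image)
    ultimately show False using card_poly_roots_bound[OF nz] by linarith
  qed
  then show ?thesis by simp
qed

text \<open>Counting zeros excludes degeneracy. With M the larger degree of p and q, alternation
  produces N + M + 1 zeros of h, whose degree is at most 2 M + 1. As M <= N, this forces M = N, and
  the zeros found are all zeros of h.\<close>

lemma best_sqrt_approx_structure:
  assumes best: "best_sqrt_approx N p q"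
  obtains c :: real and \<tau> x :: "nat \<Rightarrow> real" where
    "c \<noteq> 0" "degree q = N"
    "\<And>t. t * poly q (t\<^sup>2) - poly p (t\<^sup>2) = c * (\<Prod>i<2 * N + 1. t - \<tau> i)"
    "\<And>i. i < 2 * N + 1 \<Longrightarrow> x i < \<tau> i \<and> \<tau> i < x (Suc i)"
    "\<And>i. i \<le> 2 * N + 1 \<Longrightarrow> x i \<in> {0..1} \<and> \<bar>sqrt_residual p q ((x i)\<^sup>2)\<bar> = sqrt_err p q"
    "\<And>i. i < 2 * N + 1 \<Longrightarrow> sqrt_residual p q ((x (Suc i))\<^sup>2) = - sqrt_residual p q ((x i)\<^sup>2)"
proof -
  define M where "M = max (degree p) (degree q)"
  define h where "h = residual_numerator p q"
  have cand: "rat_cand N p q" using best by (auto simp: best_sqrt_approx_def)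
  then have "M \<le> N" by (auto simp: rat_cand_def M_def)
  have Epos: "0 < sqrt_err p q" by (rule sqrt_err_pos[OF cand])
  obtain z where z: "\<And>i. i \<le> N + M \<Longrightarrow> z i < z (Suc i)"
    "\<And>i. i \<le> Suc (N + M) \<Longrightarrow> z i \<in> {0..1} \<and> \<bar>sqrt_residual p q (z i)\<bar> = sqrt_err p q"
    "\<And>i. i \<le> N + M \<Longrightarrow> sqrt_residual p q (z (Suc i)) = - sqrt_residual p q (z i)"
    using best_sqrt_approx_alternation[OF best] unfolding M_def by metis
  define x where "x i = sqrt (z i)" for i
  have x: "x i \<in> {0..1}" "(x i)\<^sup>2 = z i" if "i \<le> Suc (N + M)" for i
    using z(2)[OF that] by (auto simp: x_def)
  have xmono: "x i < x (Suc i)" if "i \<le> N + M" for i using z(1)[OF that] by (simp add: x_def)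
  have "\<exists>\<tau>. x i < \<tau> \<and> \<tau> < x (Suc i) \<and> poly h \<tau> = 0" if i: "i \<le> N + M" for i
  proof -
    have nz: "\<forall>x\<in>{0..1}. poly q x \<noteq> 0" using cand by (auto simp: rat_cand_def)
    have mem: "z i \<in> {0..1}" "z (Suc i) \<in> {0..1}" using z(2) i by auto
    have hx: "poly h (x i) = sqrt_residual p q (z i) * poly q (z i)"
      "poly h (x (Suc i)) = sqrt_residual p q (z (Suc i)) * poly q (z (Suc i))"
      using residual_numerator_eq[of q "x i" p] residual_numerator_eq[of q "x (Suc i)" p] x[of i] x[of "Suc i"] i nz mem
      by (auto simp: h_def)
    \<comment> \<open>The residual changes sign between consecutive extremal points while q does
      not, so h changes sign as well.\<close>
    have "poly h (x i) * poly h (x (Suc i)) =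
        - ((sqrt_residual p q (z i))\<^sup>2 * (poly q (z i) * poly q (z (Suc i))))"
      unfolding hx z(3)[OF i] by (simp add: power2_eq_square algebra_simps)
    moreover have "0 < (sqrt_residual p q (z i))\<^sup>2" using z(2)[of i] i Epos by auto
    ultimately have "poly h (x i) * poly h (x (Suc i)) < 0"
      using poly_same_sign[OF nz mem] by (simp add: mult_pos_pos)
    then show ?thesis using poly_IVT[OF xmono[OF i], of h] by blast
  qed
  then obtain \<tau> where \<tau>: "\<And>i. i \<le> N + M \<Longrightarrow> x i < \<tau> i \<and> \<tau> i < x (Suc i) \<and> poly h (\<tau> i) = 0"
    by metis
  have tmono: "i < j \<Longrightarrow> j \<le> N + M \<Longrightarrow> \<tau> i < x j" for i j
  proof (induction j)
    case (Suc j)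
    then show ?case using \<tau>[of i] xmono[of j] by (cases "i = j") auto
  qed simp
  have "strict_mono_on {..<Suc (N + M)} \<tau>"
  proof (rule strict_mono_onI)
    fix i j assume "i \<in> {..<Suc (N + M)}" "j \<in> {..<Suc (N + M)}" "i < j"
    then show "\<tau> i < \<tau> j" using tmono[of i j] \<tau>[of j] by auto
  qed
  then have inj: "inj_on \<tau> {..<Suc (N + M)}" by (rule strict_mono_on_imp_inj_on)
  have hnz: "h \<noteq> 0" unfolding h_def by (rule residual_numerator_nonzero[OF cand])
  have hdeg: "degree h \<le> 2 * M + 1" unfolding h_def M_def by (rule degree_residual_numerator_le)
  have "\<tau> ` {..<Suc (N + M)} \<subseteq> {t. poly h t = 0}" using \<tau> by auto
  then have "card (\<tau> ` {..<Suc (N + M)}) \<le> card {t. poly h t = 0}"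
    by (intro card_mono poly_roots_finite[OF hnz])
  also have "\<dots> \<le> degree h" by (rule card_poly_roots_bound[OF hnz])
  finally have card: "Suc (N + M) \<le> degree h" using inj by (simp add: card_image)
  then have MN: "M = N" using hdeg \<open>M \<le> N\<close> by linarith
  then have hdeg': "degree h = 2 * N + 1" using card hdeg by simp
  have prod: "h = smult (coeff h (2 * N + 1)) (\<Prod>i<2 * N + 1. [:- \<tau> i, 1:])"
  proof (rule poly_eq_prod_roots)
    show "inj_on \<tau> {..<2 * N + 1}" using inj by (simp add: MN mult_2)
    show "poly h (\<tau> i) = 0" if "i < 2 * N + 1" for i using \<tau>[of i] that MN by simp
  qed (simp add: hdeg')
  \<comment> \<open>The odd leading power t^(2N + 1) of h can only come from t q(t^2).\<close>
  have dq: "degree q = N"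
  proof (rule ccontr)
    assume "degree q \<noteq> N"
    then have "degree q < N" using cand by (auto simp: rat_cand_def)
    then have "degree ([:0, 1:] * pcompose q (monom 1 2)) \<le> 2 * N"
      by (intro order_trans[OF degree_mult_le]) (simp add: degree_pcompose degree_monom_eq)
    moreover have "degree (pcompose p (monom 1 2)) \<le> 2 * N"
      using cand by (simp add: degree_pcompose degree_monom_eq rat_cand_def)
    ultimately have "degree h \<le> 2 * N"
      unfolding h_def residual_numerator_def by (intro degree_diff_le)
    then show False using hdeg' by simp
  qed
  show ?thesis
  proof (rule that)
    show "coeff h (2 * N + 1) \<noteq> 0" using hnz hdeg' by (metis leading_coeff_0_iff)
    show "degree q = N" by fact
    show "t * poly q (t\<^sup>2) - poly p (t\<^sup>2) = coeff h (2 * N + 1) * (\<Prod>i<2 * N + 1. t - \<tau> i)" for t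
    proof -
      have "poly h t = poly (smult (coeff h (2 * N + 1)) (\<Prod>i<2 * N + 1. [:- \<tau> i, 1:])) t"
        by (rule arg_cong[OF prod])
      moreover have "poly [:- \<tau> i, 1:] t = t - \<tau> i" for i by simp
      moreover have "poly h t = t * poly q (t\<^sup>2) - poly p (t\<^sup>2)"
        unfolding h_def by (rule poly_residual_numerator)
      ultimately show ?thesis by (simp only: poly_smult poly_prod)
    qed
    show "x i < \<tau> i \<and> \<tau> i < x (Suc i)" if "i < 2 * N + 1" for i using \<tau>[of i] that MN by simp
    show "x i \<in> {0..1} \<and> \<bar>sqrt_residual p q ((x i)\<^sup>2)\<bar> = sqrt_err p q" if "i \<le> 2 * N + 1" for i
      using x[of i] z(2)[of i] that MN by simp
    show "sqrt_residual p q ((x (Suc i))\<^sup>2) = - sqrt_residual p q ((x i)\<^sup>2)" if "i < 2 * N + 1" for i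
      using x[of i] x[of "Suc i"] z(3)[of i] that MN by simp
  qed
qed

section \<open>Location of the poles\<close>

lemma poly_map_poly_of_real:
  "poly (map_poly complex_of_real q) (of_real x) = of_real (poly q x)"
  by (induction q) (auto simp: map_poly_pCons)

lemma prod_polar:
  fixes n :: nat
  shows "(\<Prod>i<n. complex_of_real (r i) * cis (\<phi> i)) = of_real (\<Prod>i<n. r i) * cis (\<Sum>i<n. \<phi> i)"
  by (induction n) (simp_all add: cis_mult[symmetric] mult_ac)

lemma imaginary_minus_real_polar:
  assumes "0 < y"
  shows "\<i> * complex_of_real y - of_real \<tau>
    = of_real (y * sqrt (1 + (\<tau> / y)\<^sup>2)) * cis (arctan (\<tau> / y) + pi / 2)"
proof -
  have "sqrt (1 + (\<tau> / y)\<^sup>2) \<noteq> 0" by (simp add: add_nonneg_eq_0_iff)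
  then show ?thesis
    using assms by (simp add: complex_eq_iff cos_add sin_add cos_arctan sin_arctan)
qed

text \<open>The identity passes from the real line to the complex plane because the difference of
  the two sides is a polynomial with infinitely many zeros.\<close>

lemma complexified_numerator:
  fixes p q :: "real poly" and \<tau> :: "nat \<Rightarrow> real"
  assumes h: "\<And>t. t * poly q (t\<^sup>2) - poly p (t\<^sup>2) = c * (\<Prod>i<n. t - \<tau> i)"
  shows "z * poly (map_poly of_real q) (z\<^sup>2) - poly (map_poly of_real p) (z\<^sup>2)
    = complex_of_real c * (\<Prod>i<n. z - of_real (\<tau> i))"
proof -
  define D where "D = [:0, 1:] * pcompose (map_poly complex_of_real q) (monom 1 2)
    - pcompose (map_poly complex_of_real p) (monom 1 2)
    - smult (of_real c) (\<Prod>i<n. [:- of_real (\<tau> i), 1:])"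
  have lin: "poly [:- of_real (\<tau> i), 1:] w = w - complex_of_real (\<tau> i)" for w i by simp
  have D: "poly D w = w * poly (map_poly of_real q) (w\<^sup>2) - poly (map_poly of_real p) (w\<^sup>2)
      - of_real c * (\<Prod>i<n. w - of_real (\<tau> i))" for w
    unfolding D_def by (simp only: poly_diff poly_smult poly_prod lin)
      (simp add: poly_pcompose poly_monom)
  have "poly D (of_real t) = 0" for t
  proof -
    have "poly D (of_real t) = of_real (t * poly q (t\<^sup>2) - poly p (t\<^sup>2) - c * (\<Prod>i<n. t - \<tau> i))"
      unfolding D by (simp add: poly_map_poly_of_real flip: of_real_power)
    then show ?thesis using h[of t] by simp
  qed
  then have "range complex_of_real \<subseteq> {z. poly D z = 0}" by auto
  moreover have "infinite (range complex_of_real)"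
    using finite_imageD[of complex_of_real UNIV] infinite_UNIV_char_0[where 'a = real]
    by (auto simp: inj_on_def)
  ultimately have "D = 0" using poly_roots_finite[of D] finite_subset by blast
  then show ?thesis using D[of z] by simp
qed

text \<open>At z = i/s the square z^2 = -1/s^2 is real, so q(z^2)/s is the imaginary part of c times
  the product over the zeros. The product is real when its arguments arctan(\<tau> i * s) + pi/2 add
  up to a multiple of pi.\<close>

lemma arctan_sum_imp_root:
  fixes p q :: "real poly" and \<tau> :: "nat \<Rightarrow> real"
  assumes h: "\<And>t. t * poly q (t\<^sup>2) - poly p (t\<^sup>2) = c * (\<Prod>i<2 * N + 1. t - \<tau> i)"
    and "0 < s" "(\<Sum>i<2 * N + 1. arctan (\<tau> i * s)) = (2 * real k + 1) * pi / 2"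
  shows "poly q (- (1 / s\<^sup>2)) = 0"
proof -
  define y where "y = 1 / s"
  define \<rho> where "\<rho> = (\<Prod>i<2 * N + 1. y * sqrt (1 + (\<tau> i / y)\<^sup>2))"
  have y: "0 < y" "\<And>i. \<tau> i / y = \<tau> i * s" using assms(2) by (auto simp: y_def)
  let ?z = "\<i> * complex_of_real y"
  have z2: "?z\<^sup>2 = of_real (- (1 / s\<^sup>2))" by (simp add: y_def power_mult_distrib power_divide)
  \<comment> \<open>The odd number 2N + 1 of summands pi/2 completes the odd multiple of pi/2 to (k
    + N + 1) pi.\<close>
  have "(\<Sum>i<2 * N + 1. arctan (\<tau> i / y) + pi / 2) = (2 * real k + 1) * pi / 2 + real (2 * N + 1) * (pi / 2)"
    unfolding sum.distrib sum_constant card_lessThan y(2) assms(3) by simp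
  also have "\<dots> = real (k + N + 1) * pi" by (simp add: field_simps)
  finally have arg: "(\<Sum>i<2 * N + 1. arctan (\<tau> i / y) + pi / 2) = real (k + N + 1) * pi" .
  have "?z * poly (map_poly of_real q) (?z\<^sup>2) - poly (map_poly of_real p) (?z\<^sup>2)
      = complex_of_real c * (\<Prod>i<2 * N + 1. ?z - of_real (\<tau> i))"
    by (rule complexified_numerator[OF h])
  also have "(\<Prod>i<2 * N + 1. ?z - of_real (\<tau> i)) = of_real \<rho> * cis (real (k + N + 1) * pi)"
    unfolding imaginary_minus_real_polar[OF y(1)] prod_polar arg \<rho>_def ..
  finally have "Im (?z * of_real (poly q (- (1 / s\<^sup>2))) - of_real (poly p (- (1 / s\<^sup>2))))
      = Im (of_real c * (of_real \<rho> * cis (real (k + N + 1) * pi)))"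
    unfolding z2 poly_map_poly_of_real by simp
  then have "y * poly q (- (1 / s\<^sup>2)) = c * \<rho> * sin (real (k + N + 1) * pi)" by simp
  also have "sin (real (k + N + 1) * pi) = 0" by (rule sin_npi)
  finally show ?thesis using y(1) by simp
qed

section \<open>Sums of arctangents\<close>

lemma arctan_ge_quotient:
  assumes "0 \<le> x"
  shows "x / (1 + x\<^sup>2) \<le> arctan x"
proof -
  have "arctan 0 - 0 / (1 + 0\<^sup>2) \<le> arctan x - x / (1 + x\<^sup>2)"
  proof (rule DERIV_nonneg_imp_nondecreasing[OF assms])
    fix u :: real
    have nz: "1 + u\<^sup>2 \<noteq> 0" by (simp add: add_nonneg_eq_0_iff)
    have "((\<lambda>u. arctan u - u / (1 + u\<^sup>2)) has_real_derivative
        inverse (1 + u\<^sup>2) - ((1 + u\<^sup>2) - u * (2 * u)) / (1 + u\<^sup>2)\<^sup>2) (at u)"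
      using nz by (auto intro!: derivative_eq_intros simp: power2_eq_square)
    moreover have "inverse (1 + u\<^sup>2) - ((1 + u\<^sup>2) - u * (2 * u)) / (1 + u\<^sup>2)\<^sup>2 = 2 * u\<^sup>2 / (1 + u\<^sup>2)\<^sup>2"
    proof -
      have "inverse d - (d - u * (2 * u)) / d\<^sup>2 = 2 * u\<^sup>2 / d\<^sup>2" if "d \<noteq> 0" for d
        using that by (simp add: field_simps power2_eq_square)
      then show ?thesis using nz by blast
    qed
    ultimately show "\<exists>d. ((\<lambda>u. arctan u - u / (1 + u\<^sup>2)) has_real_derivative d) (at u) \<and> 0 \<le> d"
      by (metis divide_nonneg_nonneg mult_nonneg_nonneg zero_le_numeral zero_le_power2)
  qed
  then show ?thesis by simp
qed

text \<open>Every \<tau> i is below 1, so x/(1 + x^2) <= arctan x <= x holds with the common factor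
  1 + s^2 for all summands, whatever their number.\<close>

lemma arctan_sum_bounds:
  fixes \<tau> :: "nat \<Rightarrow> real"
  assumes "\<And>i. i < n \<Longrightarrow> 0 < \<tau> i \<and> \<tau> i < 1" "0 \<le> s"
  defines "S \<equiv> \<Sum>i<n. \<tau> i"
  shows "(\<Sum>i<n. arctan (\<tau> i * s)) \<le> S * s" "S * s / (1 + s\<^sup>2) \<le> (\<Sum>i<n. arctan (\<tau> i * s))"
proof -
  show "(\<Sum>i<n. arctan (\<tau> i * s)) \<le> S * s"
    unfolding S_def sum_distrib_right
    using assms by (intro sum_mono arctan_le_self mult_nonneg_nonneg) (auto intro: less_imp_le)
  have "S * s / (1 + s\<^sup>2) = (\<Sum>i<n. \<tau> i * s / (1 + s\<^sup>2))"
    by (simp add: S_def sum_distrib_right sum_divide_distrib)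
  also have "\<dots> \<le> (\<Sum>i<n. arctan (\<tau> i * s))"
  proof (rule sum_mono)
    fix i assume "i \<in> {..<n}"
    then have i: "0 < \<tau> i" "\<tau> i < 1" using assms by auto
    have "\<tau> i * s \<le> 1 * s" using i assms by (intro mult_right_mono) auto
    then have "(\<tau> i * s)\<^sup>2 \<le> s\<^sup>2" using i assms by (intro power_mono) auto
    then have "\<tau> i * s / (1 + s\<^sup>2) \<le> \<tau> i * s / (1 + (\<tau> i * s)\<^sup>2)"
      using i assms by (intro divide_left_mono mult_pos_pos) (auto intro: add_pos_nonneg)
    also have "\<dots> \<le> arctan (\<tau> i * s)" using i assms by (intro arctan_ge_quotient) auto
    finally show "\<tau> i * s / (1 + s\<^sup>2) \<le> arctan (\<tau> i * s)" .
  qed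
  finally show "S * s / (1 + s\<^sup>2) \<le> (\<Sum>i<n. arctan (\<tau> i * s))" .
qed

text \<open>Intermediate values between 0 at s = 0 and the limit n pi/2 at infinity.\<close>

lemma arctan_sum_attains:
  fixes \<tau> :: "nat \<Rightarrow> real"
  assumes "\<And>i. i < n \<Longrightarrow> 0 < \<tau> i" "0 < v" "v < real n * pi / 2"
  shows "\<exists>s>0. (\<Sum>i<n. arctan (\<tau> i * s)) = v"
proof -
  let ?f = "\<lambda>s. \<Sum>i<n. arctan (\<tau> i * s)"
  have "(?f \<longlongrightarrow> (\<Sum>i<n. pi / 2)) at_top"
  proof (rule tendsto_sum)
    fix i assume "i \<in> {..<n}"
    then have "filterlim (\<lambda>s. \<tau> i * s) at_top at_top"
      using assms by (intro filterlim_tendsto_pos_mult_at_top[OF tendsto_const]) (auto intro: filterlim_ident)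
    then show "((\<lambda>s. arctan (\<tau> i * s)) \<longlongrightarrow> pi / 2) at_top"
      by (rule filterlim_compose[OF tendsto_arctan_at_top])
  qed
  then have "eventually (\<lambda>s. v < ?f s) at_top"
    using assms(3) by (intro order_tendstoD(1)) auto
  then obtain s1 where s1: "\<And>s. s1 \<le> s \<Longrightarrow> v < ?f s" by (auto simp: eventually_at_top_linorder)
  have "\<exists>s\<ge>0. s \<le> max s1 0 \<and> ?f s = v"
    using assms s1[of "max s1 0"] by (intro IVT') (auto intro!: continuous_intros)
  then obtain s where s: "0 \<le> s" "?f s = v" by blast
  moreover have "s \<noteq> 0" using s assms by auto
  ultimately show ?thesis by (intro exI[of _ s]) auto
qed

lemma arctan_sum_less_imp_less:
  fixes \<tau> :: "nat \<Rightarrow> real"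
  assumes "\<And>i. i < n \<Longrightarrow> 0 < \<tau> i" "(\<Sum>i<n. arctan (\<tau> i * s)) < (\<Sum>i<n. arctan (\<tau> i * s'))"
  shows "s < s'"
proof (rule ccontr)
  assume "\<not> s < s'"
  then have "(\<Sum>i<n. arctan (\<tau> i * s')) \<le> (\<Sum>i<n. arctan (\<tau> i * s))"
    using assms(1) by (intro sum_mono) (auto simp: arctan_le_iff intro!: mult_left_mono less_imp_le)
  then show False using assms(2) by simp
qed

text \<open>N distinct roots exhaust a polynomial of degree N, so the multiset of poles is known. As
  f decreases, the pole ranked k from the top, counting from 0, sits at position N - k - 1 of the
  list.\<close>

lemma sorted_poles_nth:
  fixes q :: "real poly" and f :: "nat \<Rightarrow> real"
  assumes deg: "degree q = N" and L: "mset L = poles q" "sorted_wrt (\<lambda>a b. cmod a \<le> cmod b) L"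
    and root: "\<And>k. k < N \<Longrightarrow> poly q (- f k) = 0" and pos: "\<And>k. k < N \<Longrightarrow> 0 < f k"
    and dec: "\<And>j k. j < k \<Longrightarrow> k < N \<Longrightarrow> f k < f j" and "k < N"
  shows "L ! (N - k - 1) = - complex_of_real (f k)"
proof -
  let ?q = "map_poly complex_of_real q"
  have "q \<noteq> 0" using deg \<open>k < N\<close> by auto
  then have qnz: "?q \<noteq> 0" by (simp add: map_poly_eq_0_iff)
  have dq: "degree ?q = N" using deg by (simp add: degree_map_poly)
  define g where "g j = - complex_of_real (f (N - 1 - j))" for j
  define L' where "L' = map g [0..<N]"
  have inj: "inj_on g {0..<N}"
  proof (rule inj_onI)
    fix i j assume ij: "i \<in> {0..<N}" "j \<in> {0..<N}" "g i = g j"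
    then have "f (N - 1 - i) = f (N - 1 - j)" by (simp add: g_def)
    moreover have "f (N - 1 - i) < f (N - 1 - j)" if "i < j" "j < N" for i j
      using that by (intro dec) linarith+
    ultimately show "i = j" using ij by (metis atLeastLessThan_iff less_irrefl linorder_neqE_nat)
  qed
  have "mset L' \<subseteq># proots ?q"
  proof -
    have "distinct L'" using inj by (simp add: L'_def distinct_map)
    then have "mset L' = mset_set (set L')" by (simp add: mset_set_set)
    also have "\<dots> \<subseteq># proots ?q"
    proof (rule subset_imp_msubset_mset_set[THEN subset_mset.trans])
      show "set L' \<subseteq> set_mset (proots ?q)"
      proof
        fix w assume "w \<in> set L'"
        then obtain j where j: "j < N" "w = of_real (- f (N - 1 - j))" by (auto simp: L'_def g_def)
        have "poly ?q w = 0" unfolding j(2) poly_map_poly_of_real using root[of "N - 1 - j"] j(1) by simp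
        then show "w \<in> set_mset (proots ?q)" using qnz by simp
      qed
      show "mset_set (set_mset (proots ?q)) \<subseteq># proots ?q" by (rule mset_set_set_mset_msubset)
    qed simp
    finally show ?thesis .
  qed
  moreover have "size (proots ?q) = size (mset L')" by (simp add: size_proots_complex dq L'_def)
  ultimately have "mset L' = proots ?q"
    using mset_subset_size[of "mset L'" "proots ?q"] by (auto simp: subset_mset_def)
  then have mset: "mset L = mset L'" using L(1) by (simp add: poles_def)
  have sL: "sorted (map cmod L)" using L(2) by (simp add: sorted_wrt_map)
  have sL': "sorted (map cmod L')"
    unfolding sorted_iff_nth_mono_less
  proof (intro allI impI)
    fix i j assume ij: "i < j" "j < length (map cmod L')"
    then have "f (N - 1 - i) < f (N - 1 - j)" using dec[of "N - 1 - j" "N - 1 - i"] by (simp add: L'_def)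
    moreover have "0 < f (N - 1 - i)" using pos ij by (simp add: L'_def)
    ultimately show "map cmod L' ! i \<le> map cmod L' ! j" using ij by (simp add: L'_def g_def)
  qed
  \<comment> \<open>Sorting determines only the moduli; the entry itself is recovered below as the
    element of \<open>L'\<close> with that modulus.\<close>
  have "mset (map cmod L) = mset (map cmod L')" using mset by simp
  then have eq: "map cmod L = map cmod L'"
    using sL sL' properties_for_sort by metis
  have len: "length L = N" using mset mset_eq_length[OF mset] by (simp add: L'_def)
  let ?j = "N - k - 1"
  have j: "?j < N" using \<open>k < N\<close> by simp
  have "cmod (L ! ?j) = map cmod L ! ?j" using j len by simp
  also have "\<dots> = cmod (g ?j)" unfolding eq using j by (simp add: L'_def)
  also have "\<dots> = f k" using pos[OF \<open>k < N\<close>] \<open>k < N\<close> by (simp add: g_def)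
  finally have cm: "cmod (L ! ?j) = f k" .
  have "L ! ?j \<in> set L'" using j len mset_eq_setD[OF mset] nth_mem[of ?j L] by simp
  then obtain i where i: "i < N" "L ! ?j = - complex_of_real (f (N - 1 - i))" by (auto simp: L'_def g_def)
  then have "f (N - 1 - i) = f k" using cm pos[of "N - 1 - i"] by simp
  then show ?thesis using i by simp
qed

section \<open>Asymptotics\<close>

lemma log_coth_ln_diff:
  assumes "0 < t" "0 < s"
  shows "log_coth (ln t - ln s) = ln \<bar>(t + s) / (t - s)\<bar>"
proof -
  have "(t / s + 1) / (t / s - 1) = (t + s) / (t - s)"
    using assms by (simp add: divide_simps)
  then show ?thesis using assms by (simp add: log_coth_def exp_diff)
qed

lemma log_potential_ln:
  assumes "0 < t" "\<And>i. i < n \<Longrightarrow> 0 < \<tau> i" "\<And>i. i < n \<Longrightarrow> t \<noteq> \<tau> i"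
  shows "log_potential n (\<lambda>i. ln (\<tau> i)) (ln t) = ln \<bar>(\<Prod>i<n. t + \<tau> i) / (\<Prod>i<n. t - \<tau> i)\<bar>"
proof -
  have pos: "0 < \<bar>(t + \<tau> i) / (t - \<tau> i)\<bar>" if "i < n" for i
    using assms(1) assms(2,3)[OF that] by auto
  have "log_potential n (\<lambda>i. ln (\<tau> i)) (ln t) = (\<Sum>i<n. ln \<bar>(t + \<tau> i) / (t - \<tau> i)\<bar>)"
    unfolding log_potential_def using assms by (intro sum.cong refl log_coth_ln_diff) auto
  also have "\<dots> = ln (\<Prod>i<n. \<bar>(t + \<tau> i) / (t - \<tau> i)\<bar>)"
    by (rule ln_prod[symmetric]) (auto dest: pos)
  also have "(\<Prod>i<n. \<bar>(t + \<tau> i) / (t - \<tau> i)\<bar>) = \<bar>(\<Prod>i<n. t + \<tau> i) / (\<Prod>i<n. t - \<tau> i)\<bar>"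
    by (simp only: abs_prod[symmetric] prod_dividef)
  finally show ?thesis .
qed

lemma log_potential_pos:
  assumes "0 < n" "\<And>i. i < n \<Longrightarrow> u \<noteq> a i"
  shows "0 < log_potential n a u"
  unfolding log_potential_def using assms by (intro sum_pos log_coth_pos) auto

text \<open>Since h(t) - h(-t) = 2 t q(t^2), the quotient of the products of t + \<tau> i and t -
  \<tau> i is (2t - e)/e, and the logarithm of its modulus is the potential at ln t. The bounds
  follow from |e| <= E, with equality at the extremal points.\<close>

lemma best_sqrt_approx_potential:
  fixes \<tau> x :: "nat \<Rightarrow> real"
  assumes cand: "rat_cand N p q" and "c \<noteq> 0"
    and h: "\<And>t. t * poly q (t\<^sup>2) - poly p (t\<^sup>2) = c * (\<Prod>i<2 * N + 1. t - \<tau> i)"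
    and inter: "\<And>i. i < 2 * N + 1 \<Longrightarrow> x i < \<tau> i \<and> \<tau> i < x (Suc i)"
    and ext: "\<And>i. i \<le> 2 * N + 1 \<Longrightarrow> x i \<in> {0..1} \<and> \<bar>sqrt_residual p q ((x i)\<^sup>2)\<bar> = sqrt_err p q"
    and alt: "\<And>i. i < 2 * N + 1 \<Longrightarrow> sqrt_residual p q ((x (Suc i))\<^sup>2) = - sqrt_residual p q ((x i)\<^sup>2)"
  shows "equioscillating_potential (2 * N + 1) (\<lambda>i. ln (\<tau> i)) (\<lambda>i. ln (x (Suc i))) (- ln (sqrt_err p q))"
proof -
  define n where "n = 2 * N + 1"
  define e where "e t = sqrt_residual p q (t\<^sup>2)" for t
  define E where "E = sqrt_err p q"
  note [simp] = n_def[symmetric]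
  have "0 < n" by (simp add: n_def del: n_def[symmetric])
  have "odd n" by (simp add: n_def del: n_def[symmetric])
  note h = h[folded n_def] and inter = inter[folded n_def] and ext = ext[folded n_def e_def E_def]
    and alt = alt[folded n_def e_def]
  have "0 < E" unfolding E_def by (rule sqrt_err_pos[OF cand])
  have \<tau>pos: "0 < \<tau> i" if "i < n" for i using inter[OF that] ext[of i] that by auto
  have xpos: "0 < x (Suc i)" if "i < n" for i using inter[OF that] \<tau>pos[OF that] by simp
  have xmono: "i \<le> j \<Longrightarrow> j \<le> n \<Longrightarrow> x i \<le> x j" for i j
  proof (induction j)
    case (Suc j)
    then show ?case using inter[of j] by (cases "i = Suc j") auto
  qed simp
  have \<tau>x: "\<tau> i \<noteq> x j" if "i < n" "j \<le> n" for i j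
    using inter[OF that(1)] xmono[of j i] xmono[of "Suc i" j] that by (cases "j \<le> i") auto
  have qnz: "poly q (t\<^sup>2) \<noteq> 0" if "t \<in> {0..1}" for t
    using cand that by (auto simp: rat_cand_def power_le_one)
  have he: "e t * poly q (t\<^sup>2) = c * (\<Prod>i<n. t - \<tau> i)" if "t \<in> {0..1}" for t
  proof -
    have "e t * poly q (t\<^sup>2) = t * poly q (t\<^sup>2) - poly p (t\<^sup>2)"
      using qnz[OF that] that by (simp add: e_def sqrt_residual_def left_diff_distrib)
    then show ?thesis using h[of t] by simp
  qed
  have hneg: "t * poly q (t\<^sup>2) + poly p (t\<^sup>2) = c * (\<Prod>i<n. t + \<tau> i)" for t
  proof -
    have "(\<Prod>i<n. - t - \<tau> i) = (\<Prod>i<n. (- 1) * (t + \<tau> i))" by (intro prod.cong) auto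
    also have "\<dots> = (- 1) ^ n * (\<Prod>i<n. t + \<tau> i)" by (simp only: prod.distrib prod_constant card_lessThan)
    finally have "(\<Prod>i<n. - t - \<tau> i) = - (\<Prod>i<n. t + \<tau> i)" using \<open>odd n\<close> by simp
    then show ?thesis using h[of "- t"] by simp
  qed
  have he': "(2 * t - e t) * poly q (t\<^sup>2) = c * (\<Prod>i<n. t + \<tau> i)" if "t \<in> {0..1}" for t
    using he[OF that] h[of t] hneg[of t] by (simp add: algebra_simps)
  have e_le: "\<bar>e t\<bar> \<le> E" if "t \<in> {0..1}" for t
    unfolding e_def E_def using that by (intro sqrt_residual_le[OF cand]) (auto simp: power_le_one)
  have enz: "e t \<noteq> 0" if "t \<in> {0..1}" "\<And>i. i < n \<Longrightarrow> t \<noteq> \<tau> i" for t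
    using he[OF that(1)] that(2) \<open>c \<noteq> 0\<close> by auto
  have pot: "log_potential n (\<lambda>i. ln (\<tau> i)) (ln t) = ln (\<bar>2 * t - e t\<bar> / \<bar>e t\<bar>)"
    if t: "t \<in> {0<..1}" "\<And>i. i < n \<Longrightarrow> t \<noteq> \<tau> i" for t
  proof -
    have t01: "t \<in> {0..1}" using t by auto
    have "(\<Prod>i<n. t + \<tau> i) / (\<Prod>i<n. t - \<tau> i) = (c * (\<Prod>i<n. t + \<tau> i)) / (c * (\<Prod>i<n. t - \<tau> i))"
      using \<open>c \<noteq> 0\<close> by simp
    also have "\<dots> = (2 * t - e t) / e t"
      unfolding he[OF t01, symmetric] he'[OF t01, symmetric] using qnz[OF t01] by simp
    finally show ?thesis using log_potential_ln[of t n \<tau>] t \<tau>pos by (simp add: abs_divide)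
  qed
  \<comment> \<open>As n is odd, \<open>x 1\<close> and \<open>x n\<close> are an even number of
    alternations apart and carry the same error.\<close>
  have alt_even: "e (x (Suc (2 * k))) = e (x 1)" if "2 * k < n" for k
    using that
  proof (induction k)
    case (Suc k)
    then show ?case using alt[of "Suc (2 * k)"] alt[of "Suc (Suc (2 * k))"] by simp
  qed simp
  have "e (x n) = e (x 1)"
    using alt_even[of N] by (simp add: n_def del: n_def[symmetric])
  \<comment> \<open>Beyond all zeros both products are positive, and e = 2 t P/(P + P')
    there.\<close>
  moreover have "0 < e (x n)"
  proof -
    have xn: "x n \<in> {0..1}" using ext by simp
    have "0 < x n" using xpos[of "n - 1"] \<open>0 < n\<close> by simp
    have "\<tau> i < x n" if "i < n" for i using inter[OF that] xmono[of "Suc i" n] that by auto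
    then have P: "0 < (\<Prod>i<n. x n - \<tau> i)" "0 < (\<Prod>i<n. x n + \<tau> i)"
      using \<tau>pos \<open>0 < x n\<close> by (auto intro!: prod_pos add_pos_pos)
    let ?P = "\<Prod>i<n. x n - \<tau> i" and ?P' = "\<Prod>i<n. x n + \<tau> i"
    have "2 * x n * poly q ((x n)\<^sup>2) = c * (?P + ?P')"
      using he[OF xn] he'[OF xn] by (simp add: algebra_simps)
    then have "e (x n) * (c * (?P + ?P')) = 2 * x n * (e (x n) * poly q ((x n)\<^sup>2))" by simp
    then have "e (x n) * (c * (?P + ?P')) = c * (2 * x n * ?P)" unfolding he[OF xn] by simp
    then have "e (x n) * (?P + ?P') = 2 * x n * ?P" using \<open>c \<noteq> 0\<close> by simp
    then have "e (x n) = 2 * x n * ?P / (?P + ?P')" using P by (simp add: field_simps)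
    then show ?thesis using P \<open>0 < x n\<close> by simp
  qed
  ultimately have e1: "e (x 1) = E" using ext[of 1] \<open>0 < n\<close> by auto
  \<comment> \<open>The potential is positive off the zeros, so |2 x - E| > E at x =
    \<open>x 1\<close>, which for positive x means x > E.\<close>
  have x1: "E < x 1"
  proof -
    have "x 1 \<in> {0<..1}" using xpos[of 0] ext[of 1] \<open>0 < n\<close> by auto
    moreover have nt: "x 1 \<noteq> \<tau> i" if "i < n" for i using \<tau>x[OF that, of 1] \<open>0 < n\<close> by auto
    moreover have "0 < log_potential n (\<lambda>i. ln (\<tau> i)) (ln (x 1))"
    proof (rule log_potential_pos)
      show "ln (x 1) \<noteq> ln (\<tau> i)" if "i < n" for i
        using \<tau>x[OF that, of 1] \<tau>pos[OF that] xpos[of 0] \<open>0 < n\<close> by auto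
    qed fact
    ultimately have "0 < ln (\<bar>2 * x 1 - E\<bar> / E)"
      using pot[of "x 1"] \<open>0 < E\<close> unfolding e1 by simp
    then have "1 < \<bar>2 * x 1 - E\<bar> / E"
      using \<open>0 < E\<close> by (smt (verit) divide_nonneg_pos ln_0 ln_gt_zero_iff)
    then show ?thesis using \<open>0 < E\<close> \<open>x 1 \<in> {0<..1}\<close> by (auto simp: abs_if split: if_splits)
  qed
  show ?thesis unfolding n_def[symmetric] E_def[symmetric]
  proof
    show "0 < n" by fact
    show "ln (\<tau> i) < ln (x (Suc i))" if "i < n" for i
      using inter[OF that] \<tau>pos[OF that] xpos[OF that] by simp
    show "ln (x (Suc i)) < ln (\<tau> (Suc i))" if "Suc i < n" for i
      using inter[OF that] \<tau>pos[OF that] xpos[of i] that by simp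
    show "- (- ln E) \<le> ln (x (Suc 0))" using x1 \<open>0 < E\<close> by simp
    show "ln (x (Suc (n - 1))) \<le> 0" using ext[of n] xpos[of "n - 1"] \<open>0 < n\<close> by simp
    show "u + - ln E \<le> log_potential n (\<lambda>i. ln (\<tau> i)) u"
      if u: "u \<in> {- (- ln E)..0}" "u \<notin> (\<lambda>i. ln (\<tau> i)) ` {..<n}" for u
    proof -
      define t where "t = exp u"
      have t: "t \<in> {0<..1}" "ln t = u" "E \<le> t"
        using u \<open>0 < E\<close> exp_le_cancel_iff[of "ln E" u] by (auto simp: t_def)
      have nt: "t \<noteq> \<tau> i" if "i < n" for i using u(2) that t(2) by auto
      have le: "\<bar>e t\<bar> \<le> E" using e_le t by auto
      have "0 < \<bar>e t\<bar>" using enz[of t] nt t by auto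
      \<comment> \<open>From |e| <= E <= t follows |2t - e| >= t.\<close>
      have "t / E \<le> \<bar>2 * t - e t\<bar> / \<bar>e t\<bar>"
        using le t \<open>0 < \<bar>e t\<bar>\<close> by (intro frac_le) auto
      then have "ln (t / E) \<le> ln (\<bar>2 * t - e t\<bar> / \<bar>e t\<bar>)"
        using t \<open>0 < E\<close> by (intro ln_mono) auto
      then show ?thesis using pot[of t] t nt \<open>0 < E\<close> by (simp add: ln_div)
    qed
    show "log_potential n (\<lambda>i. ln (\<tau> i)) (ln (x (Suc i))) \<le> ln (x (Suc i)) + - ln E + ln 3" if i: "i < n" for i
    proof -
      let ?t = "x (Suc i)"
      have t: "?t \<in> {0<..1}" using xpos[OF i] ext[of "Suc i"] i by auto
      have eE: "\<bar>e ?t\<bar> = E" using ext[of "Suc i"] i by simp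
      have Et: "E < ?t" using x1 xmono[of 1 "Suc i"] i by simp
      have nt: "?t \<noteq> \<tau> j" if "j < n" for j using \<tau>x[OF that, of "Suc i"] i by auto
      have pos: "0 < \<bar>2 * ?t - e ?t\<bar>" using eE Et by auto
      have "\<bar>2 * ?t - e ?t\<bar> / \<bar>e ?t\<bar> \<le> 3 * ?t / E"
        unfolding eE using eE Et \<open>0 < E\<close> by (intro divide_right_mono) auto
      then have "ln (\<bar>2 * ?t - e ?t\<bar> / \<bar>e ?t\<bar>) \<le> ln (3 * ?t / E)"
        using pos eE \<open>0 < E\<close> by (intro ln_mono) auto
      also have "\<dots> = ln ?t + - ln E + ln 3"
        using t \<open>0 < E\<close> by (simp add: ln_div ln_mult)
      finally show ?thesis using pot[of ?t] t nt by simp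
    qed
  qed
qed

text \<open>This comes from \<open>zero_sum_lower\<close> with d = 1/n and L >= pi sqrt n - 21; the
  loss ln n is negligible against sqrt n.\<close>

definition zero_sum_lower_bound :: "real \<Rightarrow> real" where
  "zero_sum_lower_bound n = sqrt (1 - (1 / n)\<^sup>2) * (pi * sqrt n - 21 - ln n) / pi"

text \<open>This comes from \<open>zero_sum_upper\<close> with L <= pi sqrt n and h = R^2 - 1 =
  n^(-1/8). The error terms are then of order at most n^(3/8), below the main term sqrt n.\<close>

definition zero_sum_upper_bound :: "real \<Rightarrow> real" where
  "zero_sum_upper_bound n = (sqrt (1 + n powr (-1/8)) * (pi * sqrt n + ln 3) + pi
     + 16 * n powr (-1/8) * (pi * sqrt n) + 1 / (4 * n powr (-1/8) * n powr (-1/8))) / pi"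

lemma (in equioscillating_potential) zero_sum_bounds:
  assumes "1 < n"
  shows "zero_sum_lower_bound (real n) \<le> (\<Sum>i<n. exp (a i))"
    and "(\<Sum>i<n. exp (a i)) \<le> zero_sum_upper_bound (real n)"
proof -
  let ?S = "\<Sum>i<n. exp (a i)"
  have "sqrt (L\<^sup>2) \<le> sqrt (real n * pi\<^sup>2)" using L_upper by (simp only: real_sqrt_le_iff)
  then have Lu: "L \<le> pi * sqrt (real n)" using L_nonneg by (simp add: real_sqrt_mult mult.commute)
  \<comment> \<open>With pi^2 <= 16 the bound \<open>L_lower\<close> is dominated by the square (L +
    21)^2, whose linear term is 42 L.\<close>
  have "pi * pi \<le> 4 * 4" using pi_less_4 by (intro mult_mono) auto
  then have "real n * pi\<^sup>2 \<le> (L + 21)\<^sup>2" using L_lower by (simp add: power2_eq_square algebra_simps)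
  then have "sqrt (real n * pi\<^sup>2) \<le> sqrt ((L + 21)\<^sup>2)" by (simp only: real_sqrt_le_iff)
  then have Ll: "pi * sqrt (real n) \<le> L + 21" using L_nonneg by (simp add: real_sqrt_mult mult.commute)
  have n1: "1 < real n" using assms by simp
  have "sqrt (1 - (1 / real n)\<^sup>2) * (pi * sqrt (real n) - 21 - ln (real n))
      \<le> sqrt (1 - (1 / real n)\<^sup>2) * (L + ln (1 / real n))"
    using n1 Ll by (intro mult_left_mono) (auto simp: ln_div power_le_one)
  also have "\<dots> \<le> pi * ?S" using n1 by (intro zero_sum_lower) auto
  finally show "zero_sum_lower_bound (real n) \<le> ?S"
    by (simp add: zero_sum_lower_bound_def field_simps)
  define \<rho> where "\<rho> = real n powr (-1/8)"
  have \<rho>: "0 < \<rho>" using n1 by (simp add: \<rho>_def)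
  have "pi * ?S \<le> sqrt (1 + \<rho>) * (L + ln 3) + pi + 16 * \<rho> * L + 1 / (4 * \<rho> * ((sqrt (1 + \<rho>))\<^sup>2 - 1))"
    using \<rho> by (intro zero_sum_upper) auto
  also have "(sqrt (1 + \<rho>))\<^sup>2 - 1 = \<rho>" using \<rho> by simp
  also have "sqrt (1 + \<rho>) * (L + ln 3) + pi + 16 * \<rho> * L + 1 / (4 * \<rho> * \<rho>)
      \<le> sqrt (1 + \<rho>) * (pi * sqrt (real n) + ln 3) + pi + 16 * \<rho> * (pi * sqrt (real n)) + 1 / (4 * \<rho> * \<rho>)"
    using \<rho> Lu by (intro add_mono order_refl mult_left_mono) auto
  finally show "?S \<le> zero_sum_upper_bound (real n)"
    unfolding zero_sum_upper_bound_def \<rho>_def[symmetric] by (simp add: pos_le_divide_eq mult.commute)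
qed

lemma zero_sum_bounds_asymp:
  "((\<lambda>N. zero_sum_lower_bound (2 * real N + 1) / sqrt (2 * real N)) \<longlongrightarrow> 1) at_top"
  "((\<lambda>N. zero_sum_upper_bound (2 * real N + 1) / sqrt (2 * real N)) \<longlongrightarrow> 1) at_top"
proof -
  have *: "((\<lambda>N. B (2 * real N + 1) / sqrt (2 * real N)) \<longlongrightarrow> 1) at_top"
    if B: "((\<lambda>x. B x / sqrt x) \<longlongrightarrow> 1) at_top" for B :: "real \<Rightarrow> real"
  proof -
    have "filterlim (\<lambda>N. 2 * real N + 1) at_top at_top" by real_asymp
    from filterlim_compose[OF B this]
    have "((\<lambda>N. B (2 * real N + 1) / sqrt (2 * real N + 1)) \<longlongrightarrow> 1) at_top" .
    moreover have "((\<lambda>N. sqrt ((2 * real N + 1) / (2 * real N))) \<longlongrightarrow> sqrt 1) at_top"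
      by (intro tendsto_real_sqrt) real_asymp
    ultimately have "((\<lambda>N. B (2 * real N + 1) / sqrt (2 * real N + 1) * sqrt ((2 * real N + 1) / (2 * real N)))
        \<longlongrightarrow> 1 * sqrt 1) at_top"
      by (rule tendsto_mult)
    moreover have "B (2 * real N + 1) / sqrt (2 * real N + 1) * sqrt ((2 * real N + 1) / (2 * real N))
        = B (2 * real N + 1) / sqrt (2 * real N)" for N
      by (simp only: real_sqrt_divide) simp
    ultimately show ?thesis by simp
  qed
  have "((\<lambda>x. zero_sum_lower_bound x / sqrt x) \<longlongrightarrow> 1) at_top"
    unfolding zero_sum_lower_bound_def by real_asymp
  then show "((\<lambda>N. zero_sum_lower_bound (2 * real N + 1) / sqrt (2 * real N)) \<longlongrightarrow> 1) at_top"
    by (rule *)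
  have "((\<lambda>x. zero_sum_upper_bound x / sqrt x) \<longlongrightarrow> 1) at_top"
    unfolding zero_sum_upper_bound_def by real_asymp
  then show "((\<lambda>N. zero_sum_upper_bound (2 * real N + 1) / sqrt (2 * real N)) \<longlongrightarrow> 1) at_top"
    by (rule *)
qed

text \<open>All that the limit needs about a single N: S is the sum of the zeros and s solves the
  arctangent equation for k. The last clause excludes large s, so that the factor 1 + s^2 can be
  controlled.\<close>

lemma best_sqrt_approx_pole:
  assumes best: "best_sqrt_approx N p q"
    and L: "mset L = poles q" "sorted_wrt (\<lambda>a b. cmod a \<le> cmod b) L" and "k < N"
  defines "v \<equiv> (2 * real k + 1) * pi / 2"
  shows "\<exists>S s. 0 < s \<and> L ! (N - k - 1) = - complex_of_real (1 / s\<^sup>2) \<and>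
    zero_sum_lower_bound (2 * real N + 1) \<le> S \<and> S \<le> zero_sum_upper_bound (2 * real N + 1) \<and>
    v \<le> S * s \<and> S * s \<le> v * (1 + s\<^sup>2) \<and> (2 * v < S \<longrightarrow> s \<le> 1)"
proof -
  let ?n = "2 * N + 1"
  obtain c and \<tau> x :: "nat \<Rightarrow> real" where c: "c \<noteq> 0" and deg: "degree q = N"
    and h: "\<And>t. t * poly q (t\<^sup>2) - poly p (t\<^sup>2) = c * (\<Prod>i<2 * N + 1. t - \<tau> i)"
    and inter: "\<And>i. i < 2 * N + 1 \<Longrightarrow> x i < \<tau> i \<and> \<tau> i < x (Suc i)"
    and ext: "\<And>i. i \<le> 2 * N + 1 \<Longrightarrow> x i \<in> {0..1} \<and> \<bar>sqrt_residual p q ((x i)\<^sup>2)\<bar> = sqrt_err p q"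
    and alt: "\<And>i. i < 2 * N + 1 \<Longrightarrow> sqrt_residual p q ((x (Suc i))\<^sup>2) = - sqrt_residual p q ((x i)\<^sup>2)"
    using best_sqrt_approx_structure[OF best] by metis
  have cand: "rat_cand N p q" using best by (simp add: best_sqrt_approx_def)
  interpret equioscillating_potential ?n "\<lambda>i. ln (\<tau> i)" "\<lambda>i. ln (x (Suc i))" "- ln (sqrt_err p q)"
    by (rule best_sqrt_approx_potential[OF cand c h inter ext alt])
  have \<tau>: "0 < \<tau> i \<and> \<tau> i < 1" if "i < ?n" for i
    using inter[OF that] ext[of i] ext[of "Suc i"] that by auto
  define S where "S = (\<Sum>i<?n. \<tau> i)"
  let ?f = "\<lambda>s. \<Sum>i<?n. arctan (\<tau> i * s)"
  have "(\<Sum>i<?n. exp (ln (\<tau> i))) = S" unfolding S_def using \<tau> by (intro sum.cong) auto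
  then have S: "zero_sum_lower_bound (2 * real N + 1) \<le> S" "S \<le> zero_sum_upper_bound (2 * real N + 1)"
    using zero_sum_bounds \<open>k < N\<close> by (auto simp: add.commute)
  \<comment> \<open>The N values (2j + 1) pi/2 with j < N lie below (2N + 1) pi/2, the supremum of
    the arctangent sum; they yield N distinct roots of q, hence all poles.\<close>
  have "\<exists>s>0. ?f s = (2 * real j + 1) * pi / 2" if "j < N" for j
    using \<tau> that by (intro arctan_sum_attains) (auto intro!: mult_strict_right_mono)
  then obtain s where s: "\<And>j. j < N \<Longrightarrow> 0 < s j" "\<And>j. j < N \<Longrightarrow> ?f (s j) = (2 * real j + 1) * pi / 2"
    by metis
  have s_mono: "s i < s j" if "i < j" "j < N" for i j
  proof (rule arctan_sum_less_imp_less)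
    show "?f (s i) < ?f (s j)"
      unfolding s(2)[OF that(2)] s(2)[OF less_trans[OF that]] using that by simp
  qed (use \<tau> in auto)
  have "L ! (N - k - 1) = - complex_of_real (1 / (s k)\<^sup>2)"
  proof (rule sorted_poles_nth[OF deg L _ _ _ \<open>k < N\<close>])
    show "poly q (- (1 / (s j)\<^sup>2)) = 0" if "j < N" for j
      by (rule arctan_sum_imp_root[OF h s(1)[OF that] s(2)[OF that]])
    show "0 < 1 / (s j)\<^sup>2" if "j < N" for j using s(1)[OF that] by simp
    show "1 / (s j)\<^sup>2 < 1 / (s i)\<^sup>2" if "i < j" "j < N" for i j
      using s_mono[OF that] s(1)[of i] that by (intro divide_strict_left_mono power_strict_mono) auto
  qed
  moreover have "v \<le> S * s k" "S * s k \<le> v * (1 + (s k)\<^sup>2)"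
  proof -
    have "?f (s k) = v" using s(2)[OF \<open>k < N\<close>] by (simp only: v_def)
    moreover have "0 < 1 + (s k)\<^sup>2" by (simp add: add_pos_nonneg)
    ultimately show "v \<le> S * s k" "S * s k \<le> v * (1 + (s k)\<^sup>2)"
      using arctan_sum_bounds[of ?n \<tau> "s k"] \<tau> s(1)[OF \<open>k < N\<close>]
      unfolding S_def[symmetric] by (auto simp: pos_divide_le_eq less_imp_le)
  qed
  \<comment> \<open>At s = 1 the arctangent sum is already at least S/2 > v.\<close>
  moreover have "s k \<le> 1" if "2 * v < S"
  proof -
    have "?f (s k) = v" using s(2)[OF \<open>k < N\<close>] by (simp only: v_def)
    also have "v < S * 1 / (1 + 1\<^sup>2)" using that by simp
    also have "\<dots> \<le> ?f 1" using arctan_sum_bounds(2)[of ?n \<tau> 1] \<tau> unfolding S_def by simp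
    finally have "s k < 1" by (rule arctan_sum_less_imp_less[rotated]) (use \<tau> in auto)
    then show ?thesis by simp
  qed
  ultimately show ?thesis using S s(1)[OF \<open>k < N\<close>] by blast
qed

theorem theorem2p4:
  fixes P Q :: "nat \<Rightarrow> real poly" and L :: "nat \<Rightarrow> complex list" and k :: nat
  assumes best: "\<And>N. best_sqrt_approx N (P N) (Q N)"
    and L: "\<And>N. mset (L N) = poles (Q N) \<and> sorted_wrt (\<lambda>a b. cmod a \<le> cmod b) (L N)"
  shows "(\<lambda>N. L N ! (N - k - 1)) \<sim>[at_top]
           (\<lambda>N. - complex_of_real (8 * real N / ((2 * real k + 1)^2 * pi^2)))"
proof -
  define v where "v = (2 * real k + 1) * pi / 2"
  have v: "0 < v" by (simp add: v_def)
  have "\<exists>S s. k < N \<longrightarrow> 0 < s \<and> L N ! (N - k - 1) = - complex_of_real (1 / s\<^sup>2) \<and>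
    zero_sum_lower_bound (2 * real N + 1) \<le> S \<and> S \<le> zero_sum_upper_bound (2 * real N + 1) \<and>
    v \<le> S * s \<and> S * s \<le> v * (1 + s\<^sup>2) \<and> (2 * v < S \<longrightarrow> s \<le> 1)" for N
    using best_sqrt_approx_pole[OF best[of N], of "L N" k] L[of N] unfolding v_def by blast
  then obtain S s where Ss: "\<And>N. k < N \<Longrightarrow> 0 < s N \<and> L N ! (N - k - 1) = - complex_of_real (1 / (s N)\<^sup>2) \<and>
    zero_sum_lower_bound (2 * real N + 1) \<le> S N \<and> S N \<le> zero_sum_upper_bound (2 * real N + 1) \<and>
    v \<le> S N * s N \<and> S N * s N \<le> v * (1 + (s N)\<^sup>2) \<and> (2 * v < S N \<longrightarrow> s N \<le> 1)"
    by metis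
  have ev: "eventually (\<lambda>N. k < N) at_top" by (rule eventually_gt_at_top)
  have S_lim: "((\<lambda>N. S N / sqrt (2 * real N)) \<longlongrightarrow> 1) at_top"
  proof (rule tendsto_sandwich[OF _ _ zero_sum_bounds_asymp])
    show "eventually (\<lambda>N. zero_sum_lower_bound (2 * real N + 1) / sqrt (2 * real N) \<le> S N / sqrt (2 * real N)) at_top"
      using ev by eventually_elim (intro divide_right_mono, use Ss in auto)
    show "eventually (\<lambda>N. S N / sqrt (2 * real N) \<le> zero_sum_upper_bound (2 * real N + 1) / sqrt (2 * real N)) at_top"
      using ev by eventually_elim (intro divide_right_mono, use Ss in auto)
  qed
  have S_top: "filterlim S at_top at_top"
  proof -
    have *: "filterlim (\<lambda>N. S N / sqrt (2 * real N) * sqrt (2 * real N)) at_top at_top"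
      by (rule filterlim_tendsto_pos_mult_at_top[OF S_lim]) (simp, real_asymp)
    have "eventually (\<lambda>N. S N / sqrt (2 * real N) * sqrt (2 * real N) = S N) at_top"
      using ev by eventually_elim simp
    from filterlim_cong[OF refl refl this, THEN iffD1, OF *] show ?thesis .
  qed
  \<comment> \<open>Two passes: s <= 1 gives S s <= 2 v, hence s <= 2 v/S, which tends to 0; then
    the factor 1 + s^2 tends to 1.\<close>
  have Ss_lim: "((\<lambda>N. S N * s N) \<longlongrightarrow> v) at_top"
  proof (rule tendsto_sandwich)
    show "eventually (\<lambda>N. v \<le> S N * s N) at_top" using ev by eventually_elim (simp add: Ss)
    show "eventually (\<lambda>N. S N * s N \<le> v * (1 + (2 * v / S N)\<^sup>2)) at_top"
      using ev filterlim_at_top_dense[THEN iffD1, OF S_top, rule_format, of "2 * v"]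
    proof eventually_elim
      case (elim N)
      note b = Ss[OF elim(1)]
      have s: "0 < s N" "s N \<le> 1" using b elim(2) by auto
      have "0 < S N" using elim(2) v by linarith
      have "S N * s N \<le> v * (1 + (s N)\<^sup>2)" using b by blast
      also have "\<dots> \<le> v * (1 + 1\<^sup>2)" using s v by (intro mult_left_mono add_left_mono power_mono) auto
      finally have "s N \<le> 2 * v / S N" using \<open>0 < S N\<close> by (simp add: field_simps)
      then have "v * (1 + (s N)\<^sup>2) \<le> v * (1 + (2 * v / S N)\<^sup>2)"
        using s v by (intro mult_left_mono add_left_mono power_mono) auto
      then show ?case using b by linarith
    qed
    have "((\<lambda>N. v * (1 + (2 * v / S N)\<^sup>2)) \<longlongrightarrow> v * (1 + 0\<^sup>2)) at_top"
      by (intro tendsto_intros real_tendsto_divide_at_top[OF tendsto_const S_top])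
    then show "((\<lambda>N. v * (1 + (2 * v / S N)\<^sup>2)) \<longlongrightarrow> v) at_top" by simp
  qed simp
  \<comment> \<open>This product is the quotient of the pole and its asymptotic form: it equals
    v^2/(2 N s^2), and v^2/(2 N) is the reciprocal of 8 N/((2k + 1)^2 pi^2).\<close>
  have "((\<lambda>N. (S N / sqrt (2 * real N))\<^sup>2 * (v / (S N * s N))\<^sup>2) \<longlongrightarrow> 1\<^sup>2 * (v / v)\<^sup>2) at_top"
    using v by (intro tendsto_intros S_lim Ss_lim) auto
  then have lim: "((\<lambda>N. (S N / sqrt (2 * real N))\<^sup>2 * (v / (S N * s N))\<^sup>2) \<longlongrightarrow> 1) at_top"
    using v by simp
  show ?thesis
  proof (rule asymp_equivI')
    have eq: "complex_of_real ((S N / sqrt (2 * real N))\<^sup>2 * (v / (S N * s N))\<^sup>2)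
        = L N ! (N - k - 1) / - complex_of_real (8 * real N / ((2 * real k + 1)^2 * pi^2))" if N: "k < N" for N
    proof -
      note b = Ss[OF N]
      have "S N \<noteq> 0" "s N \<noteq> 0" "0 < real N" using b v N by auto
      then have "(S N / sqrt (2 * real N))\<^sup>2 * (v / (S N * s N))\<^sup>2 = v\<^sup>2 / (2 * real N) / (s N)\<^sup>2"
        by (simp add: power_divide power_mult_distrib)
      also have "v\<^sup>2 / (2 * real N) = 1 / (8 * real N / ((2 * real k + 1)^2 * pi^2))"
        by (simp add: v_def power_divide power_mult_distrib)
      finally have "(S N / sqrt (2 * real N))\<^sup>2 * (v / (S N * s N))\<^sup>2
          = - (1 / (s N)\<^sup>2) / - (8 * real N / ((2 * real k + 1)^2 * pi^2))" by simp
      then show ?thesis using b by (simp only: of_real_divide of_real_minus)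
    qed
    have "((\<lambda>N. complex_of_real ((S N / sqrt (2 * real N))\<^sup>2 * (v / (S N * s N))\<^sup>2)) \<longlongrightarrow> of_real 1) at_top"
      by (intro tendsto_of_real lim)
    then have "((\<lambda>N. L N ! (N - k - 1) / - complex_of_real (8 * real N / ((2 * real k + 1)^2 * pi^2)))
        \<longlongrightarrow> of_real 1) at_top"
      by (rule Lim_transform_eventually) (rule eventually_mono[OF ev], erule eq)
    then show "((\<lambda>N. L N ! (N - k - 1) / - complex_of_real (8 * real N / ((2 * real k + 1)^2 * pi^2)))
        \<longlongrightarrow> 1) at_top" by simp
  qed
qed

end
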